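(* Let $d\in\mathbb{N}$ and, for each $n$, let $n_1,\dots,n_d$ (depending on $n$) be positive integers with $\sum_{\lambda=1}^d n_\lambda=n$, such that for every $\lambda$, $n_\lambda\to\infty$ and $n_\lambda/n\to\alpha_\lambda$ as $n\to\infty$. Let $J$ be a coupling matrix that is either homogeneous or heterogeneous, and let $X=(X_{\lambda i})_{1\le\lambda\le d,\,1\le i\le n_\lambda}$ be distributed according to the multi-group Curie-Weiss measure $\mathbb{P}$ with group sizes $n_1,\dots,n_d$ and coupling matrix $J$. Put $$S_\lambda:=\sum_{i=1}^{n_\lambda}X_{\lambda i},\qquad \boldsymbol{S}^n:=\left(\frac{S_1}{\sqrt{n_1}},\dots,\frac{S_d}{\sqrt{n_d}}\right),\qquad \mathcal{L}_n:=\prod_{\lambda=1}^d\frac{n_\lambda+2\mathbb{Z}}{\sqrt{n_\lambda}}\subset\mathbb{R}^d .$$ Suppose the parameters are in the high temperature regime. Then $$\sup_{x\in\mathcal{L}_n}\left|\frac{\prod_{\lambda=1}^d\sqrt{n_\lambda}}{2^d}\,\mathbb{P}\left(\boldsymbol{S}^n=x\right)-\phi_C(x)\right|\longrightarrow 0\quad\text{as } n\to\infty,$$ where $\phi_C$ is the density of the centred $d$-dimensional normal distribution $\mathcal{N}((0,\dots,0),C)$ with the positive definite covariance matrix $C$ given in the context.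
   Context: Multi-group Curie-Weiss model: for a real symmetric $d\times d$ matrix $J=(J_{\lambda\mu})$ (the coupling matrix) and group sizes $n_1,\dots,n_d$ with $\sum_\lambda n_\lambda=n$, the measure $\mathbb{P}$ (depending on $n$) on spin configurations in $\{-1,1\}^n$, indexed as $(x_{11},\dots,x_{1n_1},\dots,x_{d1},\dots,x_{dn_d})$, is $$\mathbb{P}(X_{11}=x_{11},\dots,X_{dn_d}=x_{dn_d}):=Z^{-1}\exp\left(\frac{1}{2n}\sum_{\lambda,\mu=1}^d J_{\lambda\mu}\sum_{i=1}^{n_\lambda}\sum_{j=1}^{n_\mu}x_{\lambda i}x_{\mu j}\right),$$ where $Z$ is the normalisation constant (depending on $n$ and $J$). The matrix $J$ does not depend on $n$. The limits $\alpha_\lambda=\lim_{n\to\infty} n_\lambda/n\ge 0$ satisfy $\sum_\lambda\alpha_\lambda=1$. Write $\boldsymbol{\alpha}:=\mathrm{diag}(\alpha_1,\dots,\alpha_d)$ and $\sqrt{\boldsymbol{\alpha}}:=\mathrm{diag}(\sqrt{\alpha_1},\dots,\sqrt{\alpha_d})$. Two classes of coupling matrices are considered: (1) Homogeneous: all entries of $J$ equal the same constant $\beta\ge 0$. The high temperature regime is $\beta<1$. (2) Heterogeneous: $J$ is (symmetric) positive definite. With $H:=J^{-1}-\boldsymbol{\alpha}$, the high temperature regime is the set of parameters $(\alpha_1,\dots,\alpha_d,J)$ for which $H$ is positive definite. The covariance matrix is $C=I+\sqrt{\boldsymbol{\alpha}}\,\Sigma\,\sqrt{\boldsymbol{\alpha}}$,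 where $I$ is the $d\times d$ identity matrix, and $\Sigma$ is the $d\times d$ matrix all of whose entries equal $\frac{\beta}{1-\beta}$ if $J$ is homogeneous, and $\Sigma=H^{-1}$ if $J$ is heterogeneous. *)

theory Defs
  imports "HOL-Probability.Probability"
begin

definition pos_def :: "real^'d^'d \<Rightarrow> bool" where
  "pos_def A \<longleftrightarrow> transpose A = A \<and> (\<forall>x. x \<noteq> 0 \<longrightarrow> 0 < x \<bullet> (A *v x))"

definition diag_mat :: "real^'d \<Rightarrow> real^'d^'d" where
  "diag_mat v = (\<chi> i j. if i = j then v $ i else 0)"

definition const_mat :: "real \<Rightarrow> real^'d^'d" where
  "const_mat b = (\<chi> i j. b)"

definition homogeneous :: "real \<Rightarrow> real^'d^'d \<Rightarrow> bool" where
  "homogeneous \<beta> J \<longleftrightarrow> 0 \<le> \<beta> \<and> J = const_mat \<beta>"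

definition heterogeneous :: "real^'d^'d \<Rightarrow> bool" where
  "heterogeneous J \<longleftrightarrow> pos_def J"

definition H_mat :: "real^'d \<Rightarrow> real^'d^'d \<Rightarrow> real^'d^'d" where
  "H_mat \<alpha> J = matrix_inv J - diag_mat \<alpha>"

definition cov_mat :: "real^'d \<Rightarrow> real^'d^'d \<Rightarrow> real^'d^'d" where
  "cov_mat \<alpha> S = mat 1 + diag_mat (\<chi> i. sqrt (\<alpha> $ i)) ** S ** diag_mat (\<chi> i. sqrt (\<alpha> $ i))"

text \<open>Density of the centred normal distribution with positive definite covariance matrix \<open>C\<close>.\<close>

definition normal_density_mat :: "real^'d^'d \<Rightarrow> real^'d \<Rightarrow> real" where
  "normal_density_mat C x =
     exp (- (x \<bullet> (matrix_inv C *v x)) / 2) / sqrt ((2 * pi) ^ CARD('d) * det C)"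

text \<open>Below, \<open>N \<lambda>\<close> is the size of group \<open>\<lambda>\<close>. A configuration is a function on the
  pairs \<open>(\<lambda>, i)\<close> with \<open>1 \<le> i \<le> N \<lambda>\<close>, extended by \<open>undefined\<close> outside that index set so
  that configurations correspond one-to-one to elements of the finite product.\<close>

definition spin_configs :: "('d::finite \<Rightarrow> nat) \<Rightarrow> ('d \<times> nat \<Rightarrow> real) set" where
  "spin_configs N = (SIGMA l:UNIV. {1..N l}) \<rightarrow>\<^sub>E {-1, 1}"

definition cw_weight :: "real^'d^'d \<Rightarrow> ('d::finite \<Rightarrow> nat) \<Rightarrow> ('d \<times> nat \<Rightarrow> real) \<Rightarrow> real" where
  "cw_weight J N x = exp (1 / (2 * real (\<Sum>l\<in>UNIV. N l)) *
     (\<Sum>l\<in>UNIV. \<Sum>m\<in>UNIV. J $ l $ m * (\<Sum>i=1..N l. \<Sum>j=1..N m. x (l, i) * x (m, j))))"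

definition cw_Z :: "real^'d^'d \<Rightarrow> ('d::finite \<Rightarrow> nat) \<Rightarrow> real" where
  "cw_Z J N = (\<Sum>x\<in>spin_configs N. cw_weight J N x)"

definition curie_weiss :: "real^'d^'d \<Rightarrow> ('d::finite \<Rightarrow> nat) \<Rightarrow> ('d \<times> nat \<Rightarrow> real) measure" where
  "curie_weiss J N = point_measure (spin_configs N) (\<lambda>x. ennreal (cw_weight J N x / cw_Z J N))"

definition group_sum :: "('d::finite \<Rightarrow> nat) \<Rightarrow> ('d \<times> nat \<Rightarrow> real) \<Rightarrow> 'd \<Rightarrow> real" where
  "group_sum N x l = (\<Sum>i=1..N l. x (l, i))"

definition norm_sums :: "('d::finite \<Rightarrow> nat) \<Rightarrow> ('d \<times> nat \<Rightarrow> real) \<Rightarrow> real^'d" where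
  "norm_sums N x = (\<chi> l. group_sum N x l / sqrt (real (N l)))"

definition sum_lattice :: "('d::finite \<Rightarrow> nat) \<Rightarrow> (real^'d) set" where
  "sum_lattice N = {x. \<forall>l. \<exists>k::int. x $ l = (real (N l) + 2 * of_int k) / sqrt (real (N l))}"

lemma finite_spin_configs: "finite (spin_configs N)"
  unfolding spin_configs_def by (intro finite_PiE finite_SigmaI) auto

lemma cw_Z_pos: "cw_Z J N > 0"
proof -
  have "spin_configs N \<noteq> {}"
    unfolding spin_configs_def by (simp add: PiE_eq_empty_iff)
  then show ?thesis
    unfolding cw_Z_def by (intro sum_pos finite_spin_configs) (auto simp: cw_weight_def)
qed

lemma prob_space_curie_weiss: "prob_space (curie_weiss J N)"
proof -
  have "(\<Sum>x\<in>spin_configs N. cw_weight J N x / cw_Z J N) = 1"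
    using cw_Z_pos[of J N] by (simp add: cw_Z_def flip: sum_divide_distrib)
  then show ?thesis
    unfolding curie_weiss_def using cw_Z_pos[of J N]
    by (intro prob_spaceI)
      (simp add: emeasure_point_measure_finite finite_spin_configs space_point_measure
        sum_ennreal cw_weight_def)
qed

lemma measure_curie_weiss_singleton:
  assumes "x \<in> spin_configs N"
  shows "measure (curie_weiss J N) {x} = cw_weight J N x / cw_Z J N"
  using assms cw_Z_pos[of J N] unfolding curie_weiss_def
  by (simp add: measure_def emeasure_point_measure_finite finite_spin_configs cw_weight_def)

end

theory Submission
  imports Defs
begin

text \<open>Counting configurations by their group sums, \<open>P(S = x)\<close> is a constant times a product of binomial
  coefficients times \<open>exp (x \<bullet> A\<^sub>n x / 2)\<close>, where \<open>A\<^sub>n\<close> tends to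
  \<open>A = \<surd>\<alpha> J \<surd>\<alpha>\<close>. Each binomial coefficient, divided by the central one, is a product of factors
  \<open>(1 - u) / (1 + u)\<close>; hence it tends to \<open>exp (- x\<^sub>l\<^sup>2 / 2)\<close> locally uniformly and is at most
  \<open>e\<close> times that. High temperature means that \<open>Q = I - A\<close> is positive definite, and
  \<open>C = Q\<^sup>-\<^sup>1\<close> by the Woodbury identity, so the rescaled weights converge uniformly to
  \<open>exp (- x \<bullet> Q x / 2)\<close> and have a common Gaussian majorant. The probabilities sum to 1, so dominated
  convergence for the step functions on the lattice cells yields the limit of the normalising
  constant; neither Stirling's formula nor the asymptotics of \<open>Z\<close> is needed.\<close>

section \<open>Gaussian integrals\<close>

text \<open>Near the critical temperature \<open>Q\<close> may be coercive with an arbitrarily small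
  constant. A majorant that lost anything in the coefficient 1/2 of the binomial exponent could then
  fail to be integrable against exp (x \<bullet> A x / 2). Hence the global bound may cost a
  constant factor but keeps that coefficient exactly, and the margin of \<open>Q\<close> is spent
  only on the difference between the finite-size coupling and \<open>A\<close>. The two-sided
  estimate is wanted only on balls of fixed radius. \<open>Q\<close> is reached from the covariance
  side: \<open>C\<close> is the identity plus a semidefinite matrix, so it is visibly positive
  definite, and a symmetric inverse inherits this. The route never inverts the diagonal matrix of
  \<alpha>, so groups of vanishing proportion are included. Both classes of couplings enter through
  one identity, \<Sigma> - \<Sigma> \<alpha> J = J. The Gaussian mass comes from a basis orthonormal
  for \<open>Q\<close>, found by Gram-Schmidt, and the linear substitution that it defines.\<close>

lemma nn_integral_lborel_split_coordinate:
  fixes h :: "'a::euclidean_space \<Rightarrow> ennreal"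
  assumes [measurable]: "h \<in> borel_measurable borel" and a: "a \<in> Basis"
  shows "(\<integral>\<^sup>+x. h x \<partial>lborel) =
    (\<integral>\<^sup>+f. (\<integral>\<^sup>+y. h (y *\<^sub>R a + (\<Sum>k\<in>Basis - {a}. f k *\<^sub>R k)) \<partial>lborel)
      \<partial>Pi\<^sub>M (Basis - {a}) (\<lambda>_. lborel))"
proof -
  interpret product_sigma_finite "\<lambda>_::'a. lborel :: real measure" by standard
  have ins: "insert a (Basis - {a}) = (Basis :: 'a set)" using a by auto
  have "(\<integral>\<^sup>+x. h x \<partial>lborel) = (\<integral>\<^sup>+f. h (\<Sum>b\<in>Basis. f b *\<^sub>R b) \<partial>Pi\<^sub>M Basis (\<lambda>_. lborel))"
    by (subst lborel_eq) (simp add: nn_integral_distr)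
  also have "\<dots> = (\<integral>\<^sup>+f. h (\<Sum>b\<in>insert a (Basis - {a}). f b *\<^sub>R b) \<partial>Pi\<^sub>M (insert a (Basis - {a})) (\<lambda>_. lborel))"
    by (simp only: ins)
  also have "\<dots> = (\<integral>\<^sup>+f. (\<integral>\<^sup>+y. h (\<Sum>b\<in>insert a (Basis - {a}). (f(a := y)) b *\<^sub>R b) \<partial>lborel)
      \<partial>Pi\<^sub>M (Basis - {a}) (\<lambda>_. lborel))"
    by (rule product_nn_integral_insert) auto
  also have "\<dots> = (\<integral>\<^sup>+f. (\<integral>\<^sup>+y. h (y *\<^sub>R a + (\<Sum>k\<in>Basis - {a}. f k *\<^sub>R k)) \<partial>lborel)
      \<partial>Pi\<^sub>M (Basis - {a}) (\<lambda>_. lborel))"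
  proof -
    have "(\<Sum>b\<in>insert a (Basis - {a}). (f(a := y)) b *\<^sub>R b) = y *\<^sub>R a + (\<Sum>k\<in>Basis - {a}. f k *\<^sub>R k)"
      for f :: "'a \<Rightarrow> real" and y
      by (subst sum.insert) (auto intro!: sum.cong)
    then show ?thesis by simp
  qed
  finally show ?thesis .
qed

text \<open>With the coordinates other than \<open>a\<close> held fixed,
  \<open>x \<bullet> b\<close> is constant because \<open>b\<close> differs from \<open>a\<close>,
  so the shear only translates the inner one-dimensional integral.\<close>

lemma nn_integral_lborel_shear:
  fixes g :: "'a::euclidean_space \<Rightarrow> ennreal"
  assumes [measurable]: "g \<in> borel_measurable borel" and a: "a \<in> Basis" "b \<in> Basis" "a \<noteq> b"
  shows "(\<integral>\<^sup>+x. g (x + (c * (x \<bullet> b)) *\<^sub>R a) \<partial>lborel) = (\<integral>\<^sup>+x. g x \<partial>lborel)"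
proof -
  have "(\<integral>\<^sup>+y. g (y *\<^sub>R a + (\<Sum>k\<in>Basis - {a}. f k *\<^sub>R k)
          + (c * ((y *\<^sub>R a + (\<Sum>k\<in>Basis - {a}. f k *\<^sub>R k)) \<bullet> b)) *\<^sub>R a) \<partial>lborel)
      = (\<integral>\<^sup>+y. g (y *\<^sub>R a + (\<Sum>k\<in>Basis - {a}. f k *\<^sub>R k)) \<partial>lborel)" for f
  proof -
    let ?s = "\<Sum>k\<in>Basis - {a}. f k *\<^sub>R k"
    have "(\<Sum>k\<in>Basis - {a}. f k * (k \<bullet> b)) = f b"
      using a by (subst sum.remove[of _ b]) (auto simp: inner_Basis intro!: sum.neutral)
    then have "(y *\<^sub>R a + ?s) \<bullet> b = f b" for y
      using a by (simp add: inner_simps inner_sum_left inner_Basis)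
    then have *: "y *\<^sub>R a + ?s + (c * ((y *\<^sub>R a + ?s) \<bullet> b)) *\<^sub>R a = (c * f b + 1 * y) *\<^sub>R a + ?s" for y
      by (simp add: algebra_simps)
    show ?thesis unfolding *
      by (subst nn_integral_real_affine[where c=1 and t="c * f b"]) auto
  qed
  then show ?thesis
    by (subst (1 2) nn_integral_lborel_split_coordinate[OF _ a(1)]) simp_all
qed

text \<open>Lebesgue measure is determined by its values on boxes, and permuting coordinates sends a
  box to one with the same side lengths in another order.\<close>

lemma nn_integral_lborel_permute_vec:
  fixes g :: "real^'n \<Rightarrow> ennreal"
  assumes [measurable]: "g \<in> borel_measurable borel" and p: "p permutes (UNIV :: 'n set)"
  shows "(\<integral>\<^sup>+x. g (\<chi> i. x $ p i) \<partial>lborel) = (\<integral>\<^sup>+x. g x \<partial>lborel)"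
proof -
  let ?h = "\<lambda>x::real^'n. \<chi> i. x $ p i"
  have "continuous_on UNIV ?h"
    by (intro continuous_intros)
  then have [measurable]: "?h \<in> borel_measurable borel"
    by (rule borel_measurable_continuous_onI)
  let ?r = "\<lambda>x::real^'n. \<chi> i. x $ inv p i"
  have "lborel = distr lborel borel ?h"
  proof (rule lborel_eqI)
    fix l u :: "real^'n" assume *: "\<And>b. b \<in> Basis \<Longrightarrow> l \<bullet> b \<le> u \<bullet> b"
    have le: "l $ i \<le> u $ i" for i using *[of "axis i 1"] by (simp add: inner_axis axis_in_Basis_iff)
    have eq: "?h -` box l u = box (?r l) (?r u)"
      using permutes_inverses[OF p] by (auto simp: mem_box_cart) metis+
    have "emeasure (distr lborel borel ?h) (box l u) = emeasure lborel (box (?r l) (?r u))"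
      by (simp add: emeasure_distr eq)
    also have "\<dots> = (\<Prod>b\<in>Basis. (?r u - ?r l) \<bullet> b)"
      by (rule emeasure_lborel_box) (auto simp: Basis_vec_def inner_axis le)
    also have "(\<Prod>b\<in>Basis. (?r u - ?r l) \<bullet> b) = (\<Prod>i\<in>UNIV. (u - l) $ inv p i)"
      by (simp add: Basis_vec_def UNION_singleton_eq_range axis_eq_axis prod.reindex inj_on_def inner_axis)
    also have "\<dots> = (\<Prod>i\<in>UNIV. (u - l) $ i)"
      using prod.permute[OF permutes_inv[OF p], of "\<lambda>i. (u - l) $ i"] by (simp add: o_def)
    also have "\<dots> = (\<Prod>b\<in>Basis. (u - l) \<bullet> b)"
      by (simp add: Basis_vec_def UNION_singleton_eq_range axis_eq_axis prod.reindex inj_on_def inner_axis)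
    finally show "emeasure (distr lborel borel ?h) (box l u) = (\<Prod>b\<in>Basis. (u - l) \<bullet> b)" .
  qed simp
  then have "(\<integral>\<^sup>+x. g x \<partial>lborel) = (\<integral>\<^sup>+x. g x \<partial>distr lborel borel ?h)" by simp
  then show ?thesis by (simp add: nn_integral_distr)
qed

lemma matrix_vector_mult_measurable [measurable]:
  "(\<lambda>x. (A :: real^'n^'m) *v x) \<in> borel_measurable borel"
  by (intro borel_measurable_continuous_onI matrix_vector_mult_linear_continuous_on)

text \<open>The linear change of variables in \<^theory>\<open>HOL-Analysis.Change_Of_Vars\<close> requires a well-ordered
  index type.\<close>

lemma nn_integral_lborel_matrix:
  fixes A :: "real^'n^'n"
  assumes "det A \<noteq> 0" and "g \<in> borel_measurable borel"
  shows "(\<integral>\<^sup>+x. g x \<partial>lborel) = ennreal \<bar>det A\<bar> * (\<integral>\<^sup>+x. g (A *v x) \<partial>lborel)"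
proof -
  \<comment> \<open>\<open>P\<close> quantifies over all \<open>g\<close>: in the product case the
    hypothesis for \<open>B\<close> is applied to \<open>g\<close> composed with
    \<open>A\<close>.\<close>
  define P where "P A \<longleftrightarrow> (det A \<noteq> 0 \<longrightarrow> (\<forall>g\<in>borel_measurable borel.
    (\<integral>\<^sup>+x. g x \<partial>lborel) = ennreal \<bar>det A\<bar> * (\<integral>\<^sup>+x. g (A *v x) \<partial>lborel)))" for A :: "real^'n^'n"
  have "P A"
  proof (rule induct_matrix_elementary)
    fix A B :: "real^'n^'n" assume AB: "P A" "P B"
    show "P (A ** B)" unfolding P_def
    proof (intro impI ballI)
      fix g :: "real^'n \<Rightarrow> ennreal" assume [measurable]: "g \<in> borel_measurable borel" and d: "det (A ** B) \<noteq> 0"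
      then have d: "det A \<noteq> 0" "det B \<noteq> 0" by (auto simp: det_mul)
      have "(\<integral>\<^sup>+x. g x \<partial>lborel) = ennreal \<bar>det A\<bar> * (\<integral>\<^sup>+x. g (A *v x) \<partial>lborel)"
        by (rule AB(1)[unfolded P_def, rule_format, OF d(1)]) simp
      also have "(\<integral>\<^sup>+x. g (A *v x) \<partial>lborel) = ennreal \<bar>det B\<bar> * (\<integral>\<^sup>+x. g (A *v (B *v x)) \<partial>lborel)"
        by (rule AB(2)[unfolded P_def, rule_format, OF d(2)]) simp
      finally show "(\<integral>\<^sup>+x. g x \<partial>lborel) = ennreal \<bar>det (A ** B)\<bar> * (\<integral>\<^sup>+x. g ((A ** B) *v x) \<partial>lborel)"
        by (simp add: det_mul abs_mult ennreal_mult matrix_vector_mul_assoc mult.assoc)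
    qed
  next
    fix A :: "real^'n^'n" and i assume "row i A = 0"
    then show "P A" by (simp add: P_def det_zero_row)
  next
    fix A :: "real^'n^'n" assume diag: "\<And>i j. i \<noteq> j \<Longrightarrow> A $ i $ j = 0"
    show "P A" unfolding P_def
    proof (intro impI ballI)
      fix g :: "real^'n \<Rightarrow> ennreal" assume [measurable]: "g \<in> borel_measurable borel" and d: "det A \<noteq> 0"
      \<comment> \<open>The affine rule wants one scaling factor per basis vector; for diagonal
        \<open>A\<close> this form, at a unit vector, is the corresponding diagonal entry.\<close>
      let ?c = "\<lambda>v::real^'n. v \<bullet> (A *v v)"
      have Aax: "A *v axis i 1 = (A $ i $ i) *\<^sub>R axis i 1" for i
        using diag by (auto simp: vec_eq_iff matrix_vector_mul_component inner_axis axis_def inner_vec_def if_distrib cong: if_cong)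
      have c: "?c (axis i 1) = A $ i $ i" for i
        by (simp add: Aax inner_axis_axis)
      have dA: "det A = (\<Prod>i\<in>UNIV. A $ i $ i)" by (rule det_diagonal) (rule diag)
      have nz: "A $ i $ i \<noteq> 0" for i using d by (simp add: dA)
      have basis: "Basis = range (\<lambda>i. axis i (1::real) :: real^'n)" by (auto simp: Basis_vec_def)
      have T: "0 + (\<Sum>j\<in>Basis. (?c j * (x \<bullet> j)) *\<^sub>R j) = A *v x" for x
      proof -
        have "A *v x = A *v (\<Sum>j\<in>Basis. (x \<bullet> j) *\<^sub>R j)" by (simp add: euclidean_representation)
        also have "\<dots> = (\<Sum>j\<in>Basis. (x \<bullet> j) *\<^sub>R (A *v j))"
          by (simp add: linear_sum[OF matrix_vector_mul_linear] matrix_vector_mult_scaleR)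
        also have "\<dots> = (\<Sum>j\<in>Basis. (?c j * (x \<bullet> j)) *\<^sub>R j)"
          by (intro sum.cong refl) (auto simp: basis c Aax mult.commute)
        finally show ?thesis by simp
      qed
      have pr: "(\<Prod>j\<in>Basis. \<bar>?c j\<bar>) = \<bar>det A\<bar>"
        by (simp add: basis prod.reindex inj_on_def axis_eq_axis c dA abs_prod)
      have "lborel = density (distr lborel borel ((*v) A)) (\<lambda>_. ennreal \<bar>det A\<bar>)"
        using lborel_affine_euclidean[where c = ?c and t = 0] nz unfolding T pr by (force simp: basis c)
      then have "(\<integral>\<^sup>+x. g x \<partial>lborel) = (\<integral>\<^sup>+x. g x \<partial>density (distr lborel borel ((*v) A)) (\<lambda>_. ennreal \<bar>det A\<bar>))"
        by simp
      then show "(\<integral>\<^sup>+x. g x \<partial>lborel) = ennreal \<bar>det A\<bar> * (\<integral>\<^sup>+x. g (A *v x) \<partial>lborel)"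
        by (simp add: nn_integral_density nn_integral_distr nn_integral_cmult)
    qed
  next
    fix m n :: 'n assume "m \<noteq> n"
    let ?p = "Transposition.transpose m n"
    let ?A = "(\<chi> i j. mat 1 $ i $ ?p j) :: real^'n^'n"
    have p: "?p permutes UNIV" by (rule permutes_swap_id) auto
    have d: "\<bar>det ?A\<bar> = 1"
      by (simp add: det_permute_columns[OF p] sign_swap_id)
    have "?A *v x = (\<chi> i. x $ ?p i)" for x
    proof -
      have "(\<Sum>j\<in>UNIV. (if i = ?p j then 1 else 0) * x $ j) = x $ ?p i" for i
        by (subst sum.cong[OF refl, of _ _ "\<lambda>j. if j = ?p i then x $ j else 0"]) (auto)
      then show ?thesis by (auto simp: vec_eq_iff matrix_vector_mult_def mat_def)
    qed
    then show "P ?A" using nn_integral_lborel_permute_vec[OF _ p] by (simp add: P_def d)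
  next
    fix m n :: 'n and c :: real assume mn: "m \<noteq> n"
    let ?A = "(\<chi> i j. if i = m \<and> j = n then c else of_bool (i = j)) :: real^'n^'n"
    have "?A = (\<chi> k. if k = m then row m (mat 1) + c *s row n (mat 1) else row k (mat 1))"
      using mn by (auto simp: vec_eq_iff row_def mat_def)
    then have d: "det ?A = 1" by (simp add: det_row_operation[OF mn])
    have A: "?A *v x = x + (c * (x \<bullet> axis n 1)) *\<^sub>R axis m 1" for x
    proof -
      have "(\<Sum>j\<in>UNIV. (if i = m \<and> j = n then c else of_bool (i = j)) * x $ j)
         = (\<Sum>j\<in>UNIV. (if i = j then x $ j else 0) + (if j = n then (if i = m then c * x $ j else 0) else 0))" for i
        using mn by (intro sum.cong) auto
      then show ?thesis
        unfolding inner_axis by (auto simp: vec_eq_iff matrix_vector_mult_def sum.distrib axis_def cong: if_cong)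
    qed
    have ne: "axis m 1 \<noteq> (axis n 1 :: real^'n)" using mn by (simp add: axis_eq_axis)
    have basis: "axis i 1 \<in> (Basis :: (real^'n) set)" for i by (auto simp: Basis_vec_def)
    show "P ?A" unfolding P_def d A
    proof (intro impI ballI)
      fix g :: "real^'n \<Rightarrow> ennreal" assume "g \<in> borel_measurable borel"
      note shear = nn_integral_lborel_shear[OF this basis basis ne]
      show "(\<integral>\<^sup>+x. g x \<partial>lborel) = ennreal \<bar>1\<bar> * (\<integral>\<^sup>+x. g (x + (c * (x \<bullet> axis n 1)) *\<^sub>R axis m 1) \<partial>lborel)"
        by (simp only: abs_one ennreal_1 mult_1_left shear)
    qed
  qed
  then show ?thesis unfolding P_def using assms by blast
qed

lemma nn_integral_std_gauss:
  "(\<integral>\<^sup>+x. ennreal (exp (- ((x :: 'a::euclidean_space) \<bullet> x) / 2)) \<partial>lborel) =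
    ennreal (sqrt (2 * pi) ^ DIM('a))"
    (is "(\<integral>\<^sup>+x. ?f x \<partial>_) = _")
proof -
  have "?f x = (\<Prod>b\<in>Basis. ennreal (exp (- (x \<bullet> b)\<^sup>2 / 2)))" for x
  proof -
    have "- (x \<bullet> x) / 2 = (\<Sum>b\<in>Basis. - (x \<bullet> b)\<^sup>2 / 2)"
      by (subst euclidean_inner[of x x]) (simp add: power2_eq_square sum_divide_distrib sum_negf)
    then show ?thesis by (simp add: exp_sum prod_ennreal)
  qed
  moreover have "(\<integral>\<^sup>+y. ennreal (exp (- y\<^sup>2 / 2)) \<partial>lborel) = ennreal (sqrt (2 * pi))"
  proof -
    have "(\<integral>\<^sup>+y. ennreal (exp (- y\<^sup>2 / 2)) \<partial>lborel) = (\<integral>\<^sup>+y. ennreal (sqrt (2 * pi)) * ennreal (std_normal_density y) \<partial>lborel)"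
      by (intro nn_integral_cong) (simp add: std_normal_density_def ennreal_mult[symmetric])
    also have "\<dots> = ennreal (sqrt (2 * pi)) * (\<integral>\<^sup>+y. ennreal (std_normal_density y) \<partial>lborel)"
      by (rule nn_integral_cmult) simp
    also have "(\<integral>\<^sup>+y. ennreal (std_normal_density y) \<partial>lborel) = 1"
      by (subst nn_integral_eq_integral) (auto intro: integrable_normal_density simp: integral_normal_density)
    finally show ?thesis by simp
  qed
  ultimately have "(\<integral>\<^sup>+x. ?f x \<partial>lborel) = (\<Prod>b\<in>(Basis :: 'a set). ennreal (sqrt (2 * pi)))"
    using nn_integral_lborel_prod[of "\<lambda>(_::'a) y. ennreal (exp (- y\<^sup>2 / 2))"] by (simp only:) simp
  then show ?thesis
    by (simp add: ennreal_power)
qed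

section \<open>Positive definite forms and their Gaussian integrals\<close>

lemma inner_matrix_sym:
  fixes Q :: "real^'n^'n"
  assumes "transpose Q = Q"
  shows "x \<bullet> (Q *v y) = y \<bullet> (Q *v x)"
  by (metis assms dot_lmul_matrix inner_commute transpose_matrix_vector)

text \<open>Gram-Schmidt for the inner product \<open>x \<bullet> (Q *v y)\<close>: fewer than
  \<open>CARD('n)\<close> vectors do not span, and a vector outside the span, minus its projection
  with respect to \<open>Q\<close>, is nonzero and can be normalised.\<close>

lemma pos_def_orthonormal_set:
  fixes Q :: "real^'n^'n"
  assumes "pos_def Q" "k \<le> CARD('n)"
  shows "\<exists>S. finite S \<and> card S = k \<and> (\<forall>x\<in>S. x \<bullet> (Q *v x) = 1) \<and>
    (\<forall>x\<in>S. \<forall>y\<in>S. x \<noteq> y \<longrightarrow> x \<bullet> (Q *v y) = 0)"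
  using assms(2)
proof (induction k)
  case (Suc k)
  have sym: "transpose Q = Q" and pos: "\<And>x. x \<noteq> 0 \<Longrightarrow> 0 < x \<bullet> (Q *v x)"
    using assms(1) by (auto simp: pos_def_def)
  from Suc obtain S where S: "finite S" "card S = k" "\<And>x. x \<in> S \<Longrightarrow> x \<bullet> (Q *v x) = 1"
    "\<And>x y. x \<in> S \<Longrightarrow> y \<in> S \<Longrightarrow> x \<noteq> y \<Longrightarrow> x \<bullet> (Q *v y) = 0" by auto
  have "span S \<noteq> UNIV"
  proof
    assume "span S = UNIV"
    then have "dim S = CARD('n)" by (metis dim_span dim_UNIV DIM_cart DIM_real mult.right_neutral)
    with dim_le_card[OF _ S(1), of S] S(2) Suc.prems show False by (simp add: span_superset dim_le_card')
  qed
  then obtain v where v: "v \<notin> span S" by auto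
  define w where "w = v - (\<Sum>s\<in>S. (s \<bullet> (Q *v v)) *\<^sub>R s)"
  have "w \<noteq> 0"
  proof
    assume "w = 0"
    then have "v = (\<Sum>s\<in>S. (s \<bullet> (Q *v v)) *\<^sub>R s)" by (simp add: w_def)
    also have "\<dots> \<in> span S" by (intro span_sum span_mul span_base)
    finally show False using v by simp
  qed
  have orth: "s \<bullet> (Q *v w) = 0" if "s \<in> S" for s
  proof -
    have "s \<bullet> (Q *v w) = s \<bullet> (Q *v v) - (\<Sum>t\<in>S. (t \<bullet> (Q *v v)) * (s \<bullet> (Q *v t)))"
      by (simp add: w_def matrix_vector_mult_diff_distrib linear_sum[OF matrix_vector_mul_linear]
        matrix_vector_mult_scaleR inner_simps inner_sum_right)
    also have "(\<Sum>t\<in>S. (t \<bullet> (Q *v v)) * (s \<bullet> (Q *v t))) = (\<Sum>t\<in>S. if t = s then s \<bullet> (Q *v v) else 0)"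
      using S(3,4) that by (intro sum.cong) auto
    finally show ?thesis using S(1) that by simp
  qed
  define r where "r = sqrt (w \<bullet> (Q *v w))"
  have r: "r > 0" "r * r = w \<bullet> (Q *v w)" using pos[OF \<open>w \<noteq> 0\<close>] by (auto simp: r_def)
  define u where "u = (1 / r) *\<^sub>R w"
  have uu: "u \<bullet> (Q *v u) = 1"
    using r(1) by (simp add: u_def matrix_vector_mult_scaleR r(2)[symmetric])
  have su: "s \<bullet> (Q *v u) = 0" if "s \<in> S" for s
    using orth[OF that] by (simp add: u_def matrix_vector_mult_scaleR)
  have us: "u \<bullet> (Q *v s) = 0" if "s \<in> S" for s
    using su[OF that] inner_matrix_sym[OF sym] by metis
  have "u \<notin> S" using uu su by force
  then show ?case using S uu su us
    by (intro exI[of _ "insert u S"]) auto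
qed (auto intro: exI[of _ "{}"])

text \<open>The columns of \<open>B\<close> are a basis orthonormal for \<open>Q\<close>, so the
  substitution \<open>B *v y\<close> turns the form of \<open>Q\<close> into
  \<open>y \<bullet> y\<close>. This takes the place of a diagonalisation.\<close>

lemma pos_def_congruent_mat_1:
  fixes Q :: "real^'n^'n"
  assumes "pos_def Q"
  obtains B :: "real^'n^'n" where "transpose B ** Q ** B = mat 1"
proof -
  obtain S where S: "finite S" "card S = CARD('n)" "\<And>x. x \<in> S \<Longrightarrow> x \<bullet> (Q *v x) = 1"
    "\<And>x y. x \<in> S \<Longrightarrow> y \<in> S \<Longrightarrow> x \<noteq> y \<Longrightarrow> x \<bullet> (Q *v y) = 0"
    using pos_def_orthonormal_set[OF assms order_refl] by auto
  obtain f where f: "bij_betw f (UNIV :: 'n set) S"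
    using finite_same_card_bij[of "UNIV :: 'n set" S] S by auto
  define B :: "real^'n^'n" where "B = (\<chi> i j. f j $ i)"
  have fS: "f i \<in> S" for i using f by (auto simp: bij_betw_def)
  have fi: "f i = f j \<longleftrightarrow> i = j" for i j using f by (auto simp: bij_betw_def inj_on_def)
  have "(transpose B ** Q ** B) $ i $ j = f i \<bullet> (Q *v f j)" for i j
    unfolding matrix_mul_assoc[symmetric]
    by (simp add: B_def matrix_matrix_mult_def transpose_def matrix_vector_mult_def inner_vec_def)
  then have "transpose B ** Q ** B = mat 1"
    using S(3,4) fS fi by (simp add: vec_eq_iff[of "_ ** _"] vec_eq_iff[of "(_ ** _) $ _"] mat_def)
  then show ?thesis by (rule that)
qed

lemma pos_def_det_pos:
  fixes Q :: "real^'n^'n"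
  assumes "pos_def Q"
  shows "det Q > 0"
proof -
  obtain B :: "real^'n^'n" where "transpose B ** Q ** B = mat 1" by (rule pos_def_congruent_mat_1[OF assms])
  from arg_cong[OF this, of det] have "det B * det B * det Q = 1"
    by (simp add: det_mul det_transpose mult_ac)
  then show ?thesis by (metis mult_less_0_iff not_square_less_zero zero_less_mult_iff zero_less_one linorder_neqE_linordered_idom mult_zero_right)
qed

text \<open>Substituting \<open>B *v x\<close> reduces the integral to the standard Gaussian; the
  Jacobian is \<open>\<bar>det B\<bar>\<close>, where (det B)^2 det Q = 1.\<close>

lemma gauss_integral_pos_def:
  fixes Q :: "real^'n^'n"
  assumes "pos_def Q"
  shows "has_bochner_integral lborel (\<lambda>x. exp (- (x \<bullet> (Q *v x)) / 2)) (sqrt ((2 * pi) ^ CARD('n) / det Q))"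
proof (rule has_bochner_integral_nn_integral)
  have [measurable]: "(\<lambda>x. x \<bullet> (Q *v x)) \<in> borel_measurable borel" by measurable
  then show "(\<lambda>x. exp (- (x \<bullet> (Q *v x)) / 2)) \<in> borel_measurable lborel" by simp
  obtain B :: "real^'n^'n" where B: "transpose B ** Q ** B = mat 1" by (rule pos_def_congruent_mat_1[OF assms])
  from arg_cong[OF this, of det] have *: "(det B)\<^sup>2 * det Q = 1"
    by (simp add: det_mul det_transpose mult_ac power2_eq_square)
  then have "det B \<noteq> 0" by auto
  have "(B *v x) \<bullet> (Q *v (B *v x)) = x \<bullet> x" for x
  proof -
    have "(B *v x) \<bullet> (Q *v (B *v x)) = x \<bullet> ((transpose B ** Q ** B) *v x)"
      by (metis (no_types) dot_lmul_matrix inner_commute matrix_vector_mul_assoc transpose_matrix_vector transpose_transpose)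
    then show ?thesis by (simp add: B)
  qed
  then have "(\<integral>\<^sup>+x. ennreal (exp (- (x \<bullet> (Q *v x)) / 2)) \<partial>lborel) =
    ennreal \<bar>det B\<bar> * ennreal (sqrt (2 * pi) ^ CARD('n))"
    by (subst nn_integral_lborel_matrix[OF \<open>det B \<noteq> 0\<close>]) (use nn_integral_std_gauss[where 'a="real^'n"] in simp_all)
  also have "\<dots> = ennreal (sqrt ((2 * pi) ^ CARD('n) / det Q))"
  proof -
    have "1 / det Q = (det B)\<^sup>2" using * by (metis nonzero_eq_divide_eq mult_zero_right zero_neq_one)
    then have "sqrt ((2 * pi) ^ CARD('n) / det Q) = sqrt ((2 * pi) ^ CARD('n) * (det B)\<^sup>2)"
      by (metis mult.right_neutral times_divide_eq_right)
    also have "\<dots> = \<bar>det B\<bar> * sqrt (2 * pi) ^ CARD('n)"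
      by (simp only: real_sqrt_mult[of _ "(det B)\<^sup>2"] real_sqrt_abs) (simp only: real_sqrt_power mult.commute)
    finally show ?thesis by (simp only: ennreal_mult abs_ge_zero zero_le_power real_sqrt_ge_zero pi_ge_zero mult_nonneg_nonneg zero_le_numeral)
  qed
  finally show "(\<integral>\<^sup>+x. ennreal (exp (- (x \<bullet> (Q *v x)) / 2)) \<partial>lborel) = ennreal (sqrt ((2 * pi) ^ CARD('n) / det Q))" .
qed (use pos_def_det_pos[OF assms] in auto)

section \<open>Ratios of binomial coefficients\<close>

text \<open>The logarithm of the left side is -2 artanh u = -2 (u + u^3/3 + ...), whose terms all
  have the same sign. For \<open>u \<ge> 1\<close> the left side is not positive.\<close>

lemma one_minus_div_one_plus_le_exp:
  fixes u :: real assumes "0 \<le> u"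
  shows "(1 - u) / (1 + u) \<le> exp (- 2 * u)"
proof (cases "u < 1")
  case True
  have "ln ((1 - u) / (1 + u)) + 2 * u \<le> ln ((1 - 0) / (1 + 0)) + 2 * 0"
  proof (rule DERIV_nonpos_imp_nonincreasing[of 0 u "\<lambda>u. ln ((1 - u) / (1 + u)) + 2 * u"])
    fix x assume x: "0 \<le> x" "x \<le> u"
    have "((\<lambda>u. ln ((1 - u) / (1 + u)) + 2 * u) has_real_derivative (- 2 / ((1 - x) * (1 + x)) + 2)) (at x)"
      using x True by (auto intro!: derivative_eq_intros simp: divide_simps) (simp add: algebra_simps)
    moreover have "- 2 / ((1 - x) * (1 + x)) + 2 \<le> 0"
    proof -
      have "x * x < 1 * 1" using x True by (intro mult_strict_mono') auto
      then have "0 < (1 - x) * (1 + x)" "(1 - x) * (1 + x) \<le> 1" by (simp_all add: algebra_simps)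
      then show ?thesis by (simp add: field_simps)
    qed
    ultimately show "\<exists>y. DERIV (\<lambda>u. ln ((1 - u) / (1 + u)) + 2 * u) x :> y \<and> y \<le> 0" by blast
  qed (use assms in auto)
  then have "ln ((1 - u) / (1 + u)) \<le> - 2 * u" by simp
  then show ?thesis using True assms
    by (metis diff_gt_0_iff_gt divide_pos_pos exp_le_cancel_iff exp_ln le_add_same_cancel1 add_pos_nonneg zero_less_one)
next
  case False
  then have "(1 - u) / (1 + u) \<le> 0" by (simp add: divide_nonpos_pos)
  then show ?thesis by (meson exp_ge_zero order_trans)
qed

text \<open>Up to 1/2, artanh u exceeds u by at most u^3. This coefficient is generous, so that the
  derivative test comes down to x^2 (4 - 6 x^2) \<ge> 0.\<close>

lemma one_minus_div_one_plus_ge_exp: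
  fixes u :: real assumes "0 \<le> u" "u \<le> 1 / 2"
  shows "exp (- 2 * u - 2 * u ^ 3) \<le> (1 - u) / (1 + u)"
proof -
  have "ln ((1 - 0) / (1 + 0)) + 2 * 0 + 2 * 0 ^ 3 \<le> ln ((1 - u) / (1 + u)) + 2 * u + 2 * u ^ 3"
  proof (rule DERIV_nonneg_imp_nondecreasing[of 0 u "\<lambda>u. ln ((1 - u) / (1 + u)) + 2 * u + 2 * u ^ 3"])
    fix x assume x: "0 \<le> x" "x \<le> u"
    have "((\<lambda>u. ln ((1 - u) / (1 + u)) + 2 * u + 2 * u ^ 3) has_real_derivative (- 2 / ((1 - x) * (1 + x)) + 2 + 6 * x\<^sup>2)) (at x)"
      using x assms by (auto intro!: derivative_eq_intros simp: divide_simps) (simp add: algebra_simps)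
    moreover have "0 \<le> - 2 / ((1 - x) * (1 + x)) + 2 + 6 * x\<^sup>2"
    proof -
      have "x\<^sup>2 \<le> (1/2)\<^sup>2" using x assms by (intro power_mono) auto
      then have "0 \<le> x\<^sup>2 * (4 - 6 * x\<^sup>2)" by (intro mult_nonneg_nonneg) (auto simp: power2_eq_square)
      moreover have "1 - x\<^sup>2 > 0" using \<open>x\<^sup>2 \<le> (1/2)\<^sup>2\<close> by (auto simp: power2_eq_square)
      moreover have "(1 - x) * (1 + x) = 1 - x\<^sup>2" by (simp add: power2_eq_square algebra_simps)
      ultimately show ?thesis by (simp add: field_simps power2_eq_square)
    qed
    ultimately show "\<exists>y. DERIV (\<lambda>u. ln ((1 - u) / (1 + u)) + 2 * u + 2 * u ^ 3) x :> y \<and> y \<ge> 0" by blast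
  qed (use assms in auto)
  then have "- 2 * u - 2 * u ^ 3 \<le> ln ((1 - u) / (1 + u))" by simp
  moreover have "0 < (1 - u) / (1 + u)" using assms by auto
  ultimately show ?thesis by (metis exp_le_cancel_iff exp_ln)
qed

lemma binomial_step:
  assumes "i < m"
  shows "real (m choose Suc i) = real (m choose i) * (real m - real i) / (real i + 1)"
proof -
  have "Suc i * (m choose Suc i) = (m - i) * (m choose i)"
    using binomial_absorb_comp[of m i] binomial_absorption[of i m] by simp
  then have "real (Suc i * (m choose Suc i)) = real ((m - i) * (m choose i))" by simp
  then show ?thesis using assms by (simp add: of_nat_diff field_simps)
qed

text \<open>The ratio of neighbours is (m - k) / (k + 1) with \<open>k = m div 2 + s\<close>.
  Numerator and denominator have sum m + 1 and difference 2 s + 1 - (m mod 2), which is where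
  \<open>u\<close> comes from.\<close>

lemma central_binomial_step:
  fixes m s :: nat
  defines "u \<equiv> (2 * real s + 1 - real (m mod 2)) / (real m + 1)"
  assumes "m div 2 + s < m"
  shows "real (m choose (m div 2 + Suc s)) = real (m choose (m div 2 + s)) * ((1 - u) / (1 + u))"
proof -
  have m: "real m = 2 * real (m div 2) + real (m mod 2)"
    by (metis mult_div_mod_eq of_nat_add of_nat_mult of_nat_numeral)
  have "u \<ge> 0" unfolding u_def by (intro divide_nonneg_pos) auto
  have "(1 - u) / (1 + u) = ((real m + 1) * (1 - u)) / ((real m + 1) * (1 + u))" by simp
  also have "(real m + 1) * (1 - u) = 2 * (real m - real (m div 2 + s))"
    using m by (simp add: u_def field_simps)
  also have "(real m + 1) * (1 + u) = 2 * (real (m div 2 + s) + 1)"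
    using m by (simp add: u_def field_simps)
  finally have "(1 - u) / (1 + u) = (real m - real (m div 2 + s)) / (real (m div 2 + s) + 1)"
    by (simp only: mult_divide_mult_cancel_left_if) simp
  then show ?thesis using binomial_step[OF assms(2)] by simp
qed

text \<open>s^2 - e s is the sum of 2 r + 1 - e over r < s, so the exponents of the single steps add
  up to this closed form in both bounds.\<close>

lemma exponent_step:
  fixes s e M :: real
  shows "- 2 * ((s + 1) ^ 2 - e * (s + 1)) / M = - 2 * (s ^ 2 - e * s) / M + - 2 * ((2 * s + 1 - e) / M)"
proof -
  have "- 2 * ((s + 1) ^ 2 - e * (s + 1)) = - 2 * (s ^ 2 - e * s) + - 2 * (2 * s + 1 - e)"
    by (simp add: algebra_simps power2_eq_square)
  then show ?thesis by (simp only: add_divide_distrib times_divide_eq_right)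
qed

lemma central_binomial_upper:
  assumes "m div 2 + s \<le> m"
  shows "real (m choose (m div 2 + s)) \<le> real (m choose (m div 2)) *
    exp (- 2 * (real s ^ 2 - real (m mod 2) * real s) / (real m + 1))"
  using assms
proof (induction s)
  case (Suc s)
  let ?u = "(2 * real s + 1 - real (m mod 2)) / (real m + 1)"
  have u: "?u \<ge> 0" by (intro divide_nonneg_pos) auto
  have "real (m choose (m div 2 + Suc s)) = real (m choose (m div 2 + s)) * ((1 - ?u) / (1 + ?u))"
    using Suc.prems by (intro central_binomial_step) simp
  also have "\<dots> \<le> real (m choose (m div 2 + s)) * exp (- 2 * ?u)"
    using u by (intro mult_left_mono one_minus_div_one_plus_le_exp) auto
  also have "\<dots> \<le> real (m choose (m div 2)) * exp (- 2 * (real s ^ 2 - real (m mod 2) * real s) / (real m + 1)) * exp (- 2 * ?u)"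
    using Suc by (intro mult_right_mono) auto
  also have "\<dots> = real (m choose (m div 2)) * exp (- 2 * (real (Suc s) ^ 2 - real (m mod 2) * real (Suc s)) / (real m + 1))"
  proof -
    have "- 2 * (real (Suc s) ^ 2 - real (m mod 2) * real (Suc s)) / (real m + 1) =
        - 2 * (real s ^ 2 - real (m mod 2) * real s) / (real m + 1) + - 2 * ?u"
      using exponent_step[of "real s" "real (m mod 2)" "real m + 1"] by (simp only: of_nat_Suc add.commute[of 1])
    then show ?thesis by (simp only: exp_add mult.assoc)
  qed
  finally show ?case .
qed simp

text \<open>Each cubic error is replaced by that of 2 s / (m + 1), which dominates every
  \<open>u\<close> met on the way and is at most 1/2 by the hypothesis; \<open>s\<close> copies of
  it give the quartic term.\<close>

lemma central_binomial_lower: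
  assumes "4 * s \<le> m"
  shows "real (m choose (m div 2 + s)) \<ge> real (m choose (m div 2)) *
    exp (- 2 * (real s ^ 2 - real (m mod 2) * real s) / (real m + 1) - 16 * real s ^ 4 / (real m + 1) ^ 3)"
proof -
  have "real (m choose (m div 2 + r)) \<ge> real (m choose (m div 2)) *
    exp (- 2 * (real r ^ 2 - real (m mod 2) * real r) / (real m + 1) - real r * (2 * (2 * real s / (real m + 1)) ^ 3))"
    if "r \<le> s" for r
    using that
  proof (induction r)
    case (Suc r)
    let ?u = "(2 * real r + 1 - real (m mod 2)) / (real m + 1)"
    let ?w = "2 * real s / (real m + 1)"
    have u: "?u \<ge> 0" by (intro divide_nonneg_pos) auto
    have uw: "?u \<le> ?w" using Suc.prems by (intro divide_right_mono) auto
    have w: "?w \<le> 1 / 2" using assms by (simp add: field_simps)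
    have "real (m choose (m div 2)) *
      exp (- 2 * (real (Suc r) ^ 2 - real (m mod 2) * real (Suc r)) / (real m + 1) - real (Suc r) * (2 * ?w ^ 3))
      = real (m choose (m div 2)) *
      exp (- 2 * (real r ^ 2 - real (m mod 2) * real r) / (real m + 1) - real r * (2 * ?w ^ 3)) * exp (- 2 * ?u - 2 * ?w ^ 3)"
    proof -
      have "- 2 * (real (Suc r) ^ 2 - real (m mod 2) * real (Suc r)) / (real m + 1) =
        - 2 * (real r ^ 2 - real (m mod 2) * real r) / (real m + 1) + - 2 * ?u"
        using exponent_step[of "real r" "real (m mod 2)" "real m + 1"] by (simp only: of_nat_Suc add.commute[of 1])
      moreover have "real (Suc r) * (2 * ?w ^ 3) = real r * (2 * ?w ^ 3) + 2 * ?w ^ 3"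
        by (simp only: of_nat_Suc) (simp add: algebra_simps)
      ultimately have "- 2 * (real (Suc r) ^ 2 - real (m mod 2) * real (Suc r)) / (real m + 1) - real (Suc r) * (2 * ?w ^ 3)
        = (- 2 * (real r ^ 2 - real (m mod 2) * real r) / (real m + 1) - real r * (2 * ?w ^ 3)) + (- 2 * ?u - 2 * ?w ^ 3)"
        by linarith
      then show ?thesis by (simp only: exp_add mult.assoc)
    qed
    also have "\<dots> \<le> real (m choose (m div 2 + r)) * exp (- 2 * ?u - 2 * ?w ^ 3)"
      using Suc by (intro mult_right_mono) auto
    also have "\<dots> \<le> real (m choose (m div 2 + r)) * exp (- 2 * ?u - 2 * ?u ^ 3)"
    proof (rule mult_left_mono[OF _ of_nat_0_le_iff])
      have "?u ^ 3 \<le> ?w ^ 3" by (rule power_mono[OF uw u])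
      then show "exp (- 2 * ?u - 2 * ?w ^ 3) \<le> exp (- 2 * ?u - 2 * ?u ^ 3)"
        unfolding exp_le_cancel_iff by linarith
    qed
    also have "\<dots> \<le> real (m choose (m div 2 + r)) * ((1 - ?u) / (1 + ?u))"
      by (rule mult_left_mono[OF one_minus_div_one_plus_ge_exp[OF u order_trans[OF uw w]]]) (rule of_nat_0_le_iff)
    also have "\<dots> = real (m choose (m div 2 + Suc r))"
    proof (rule central_binomial_step[symmetric])
      have "2 * (m div 2) \<le> m" by simp
      with Suc.prems assms show "m div 2 + r < m" by linarith
    qed
    finally show ?case .
  qed simp
  moreover have "real s * (2 * (2 * real s / M) ^ 3) = 16 * real s ^ 4 / M ^ 3" for M
    by (simp add: power_divide eval_nat_numeral)
  ultimately show ?thesis using order_refl[of s] by metis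
qed

text \<open>The index is an integer because the lattice continues beyond the attainable sums on both
  sides; above \<open>m\<close> the binomial coefficient vanishes by itself.\<close>

definition binom_ratio :: "nat \<Rightarrow> int \<Rightarrow> real" where
  "binom_ratio m j = (if j < 0 then 0 else real (m choose nat j) / real (m choose (m div 2)))"

lemma binom_ratio_nonneg: "binom_ratio m j \<ge> 0"
  by (simp add: binom_ratio_def)

text \<open>The symmetry of the binomial coefficients folds the lower half onto the upper one. For
  odd \<open>m\<close> the offset \<open>s\<close> counts from (m - 1) / 2, hence the parity term in
  the distance to the centre.\<close>

lemma binom_ratio_eq_central:
  assumes "0 \<le> j" "j \<le> int m"
  obtains s where "m div 2 + s \<le> m"
    and "binom_ratio m j = real (m choose (m div 2 + s)) / real (m choose (m div 2))"
    and "\<bar>2 * real_of_int j - real m\<bar> = \<bar>2 * real s - real (m mod 2)\<bar>"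
proof -
  have m: "real m = 2 * real (m div 2) + real (m mod 2)"
    by (metis mult_div_mod_eq of_nat_add of_nat_mult of_nat_numeral)
  show ?thesis
  proof (cases "int (m div 2) \<le> j")
    case True
    define s where "s = nat j - m div 2"
    have s: "nat j = m div 2 + s" using True by (simp add: s_def le_nat_iff)
    have "real_of_int j = real (m div 2) + real s"
      using s assms by (metis of_nat_add of_int_of_nat_eq nat_0_le)
    then show ?thesis using assms s m
      by (intro that[of s]) (auto simp: binom_ratio_def)
  next
    case False
    define s where "s = m - nat j - m div 2"
    have j: "nat j < m div 2" using False assms by linarith
    then have s: "m - nat j = m div 2 + s" by (auto simp: s_def)
    have "real m = real (nat j) + real (m div 2) + real s"
      using s j by linarith
    then have "\<bar>2 * real_of_int j - real m\<bar> = \<bar>2 * real s - real (m mod 2)\<bar>"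
      using m assms by (auto simp: abs_if)
    moreover have "m choose nat j = m choose (m div 2 + s)"
      using binomial_symmetric[of "nat j" m] j s by simp
    ultimately show ?thesis using assms s
      by (intro that[of s]) (auto simp: binom_ratio_def)
  qed
qed

text \<open>Since e^2 = e, the exponent is -(k^2 - e) / (2 (m + 1)) in terms of the distance
  \<open>k\<close> to the centre; the last summand collects the parity and the passage from m + 1 to
  m.\<close>

lemma exponent_central:
  fixes s :: real and m e :: nat
  assumes "m > 0" "e \<le> 1" "k = 2 * s - real e"
  shows "- 2 * (s ^ 2 - real e * s) / (real m + 1) =
    - (k\<^sup>2 / (2 * real m)) + (k\<^sup>2 / real m + real e) / (2 * (real m + 1))"
proof -
  have "k\<^sup>2 = 4 * (s ^ 2 - real e * s) + (real e)\<^sup>2"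
    by (simp add: assms(3) power2_eq_square algebra_simps)
  moreover have "(real e)\<^sup>2 = real e" using assms(2) by (cases e) auto
  ultimately have *: "2 * (s ^ 2 - real e * s) = (k\<^sup>2 - real e) / 2" by simp
  define a where "a = k\<^sup>2 / real m"
  have a: "k\<^sup>2 = a * real m" "k\<^sup>2 / (2 * real m) = a / 2" "k\<^sup>2 / real m = a"
    using assms(1) by (simp_all add: a_def)
  show ?thesis unfolding minus_mult_left[symmetric] * a(2,3) unfolding a(1)
    by (simp add: divide_simps) (simp add: algebra_simps)
qed

text \<open>The product of the factors gives \<open>m + 1\<close> in place of \<open>m\<close> in the exponent; as the numerator is
  at most \<open>m\<^sup>2\<close>, the change costs no more than the factor \<open>exp 1\<close>.\<close>

lemma binom_ratio_upper:
  assumes "m > 0"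
  shows "binom_ratio m j \<le> exp 1 * exp (- ((2 * real_of_int j - real m) / sqrt (real m))\<^sup>2 / 2)"
proof (cases "0 \<le> j \<and> j \<le> int m")
  case False
  then have "binom_ratio m j = 0" by (auto simp: binom_ratio_def)
  then show ?thesis by simp
next
  case True
  then obtain s where s: "m div 2 + s \<le> m"
    "binom_ratio m j = real (m choose (m div 2 + s)) / real (m choose (m div 2))"
    "\<bar>2 * real_of_int j - real m\<bar> = \<bar>2 * real s - real (m mod 2)\<bar>"
    using binom_ratio_eq_central by metis
  let ?k = "2 * real s - real (m mod 2)"
  have k2: "(2 * real_of_int j - real m)\<^sup>2 = ?k\<^sup>2" using s(3) by (metis power2_abs)
  have "\<bar>2 * real_of_int j - real m\<bar> \<le> real m" using True by linarith
  then have "(2 * real_of_int j - real m)\<^sup>2 \<le> (real m)\<^sup>2" by (simp add: abs_le_square_iff[symmetric])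
  then have k: "?k\<^sup>2 / real m \<le> real m" using k2 assms by (simp add: field_simps power2_eq_square)
  have c: "real (m choose (m div 2)) > 0" by simp
  have "binom_ratio m j \<le> exp (- 2 * (real s ^ 2 - real (m mod 2) * real s) / (real m + 1))"
    using central_binomial_upper[OF s(1)] c by (simp only: s(2) pos_divide_le_eq mult.commute)
  also have "\<dots> = exp (- (?k\<^sup>2 / (2 * real m)) + (?k\<^sup>2 / real m + real (m mod 2)) / (2 * (real m + 1)))"
    by (subst exponent_central[OF assms _ refl]) auto
  also have "\<dots> \<le> exp (- (?k\<^sup>2 / (2 * real m)) + 1)"
  proof -
    have "real (m mod 2) \<le> 1" by simp
    then have "?k\<^sup>2 / real m + real (m mod 2) \<le> real m + 1" using k by (rule add_mono[rotated])
    then have "?k\<^sup>2 / real m + real (m mod 2) \<le> 1 * (2 * (real m + 1))" by simp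
    then have "(?k\<^sup>2 / real m + real (m mod 2)) / (2 * (real m + 1)) \<le> 1"
      by (subst pos_divide_le_eq) auto
    then show ?thesis by simp
  qed
  also have "\<dots> = exp 1 * exp (- ((2 * real_of_int j - real m) / sqrt (real m))\<^sup>2 / 2)"
    by (simp add: exp_add[symmetric] power_divide k2)
  finally show ?thesis .
qed

text \<open>Logarithms turn the product over the groups into a sum of errors. The bound on
  \<open>R\<close> ensures \<open>4 * s \<le> m\<close>; as 2 s is at most (R + 1) sqrt m, the
  quartic error is of order m^2 / m^3.\<close>

lemma binom_ratio_ln:
  assumes m: "m > 0" and R: "R \<ge> 0" "4 * (R + 1)\<^sup>2 \<le> real m"
    and t: "t = (2 * real_of_int j - real m) / sqrt (real m)" "\<bar>t\<bar> \<le> R"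
  shows "binom_ratio m j > 0" and "\<bar>ln (binom_ratio m j) + t\<^sup>2 / 2\<bar> \<le> (R + 1) ^ 4 / real m"
proof -
  have sm: "sqrt (real m) > 0" "sqrt (real m) * sqrt (real m) = real m" using m by auto
  have sR: "2 * (R + 1) \<le> sqrt (real m)"
    using R by (intro real_le_rsqrt) (simp add: power2_eq_square algebra_simps)
  have jm: "\<bar>2 * real_of_int j - real m\<bar> = \<bar>t\<bar> * sqrt (real m)"
    using sm by (simp add: t(1) abs_mult)
  also have le: "\<dots> \<le> R * sqrt (real m)" using t(2) sm by (intro mult_right_mono) auto
  also have "\<dots> \<le> sqrt (real m) * sqrt (real m)" using sR sm R by (intro mult_right_mono) auto
  finally have "\<bar>2 * real_of_int j - real m\<bar> \<le> real m" using sm by simp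
  then have "0 \<le> j \<and> j \<le> int m" by linarith
  then obtain s where s: "m div 2 + s \<le> m"
    "binom_ratio m j = real (m choose (m div 2 + s)) / real (m choose (m div 2))"
    "\<bar>2 * real_of_int j - real m\<bar> = \<bar>2 * real s - real (m mod 2)\<bar>"
    using binom_ratio_eq_central by metis
  let ?k = "2 * real s - real (m mod 2)"
  have c: "real (m choose (m div 2)) > 0" by simp
  have "real (m choose (m div 2 + s)) > 0" using s(1) by simp
  then show pos: "binom_ratio m j > 0" using c s(2) by simp
  have k2: "(2 * real_of_int j - real m)\<^sup>2 = ?k\<^sup>2" using s(3) by (metis power2_abs)
  have t2: "t\<^sup>2 = ?k\<^sup>2 / real m" using k2 by (simp add: t(1) power_divide)
  have t2R: "t\<^sup>2 \<le> R\<^sup>2" using t(2) R(1) by (simp add: abs_le_square_iff[symmetric])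
  have e1: "real (m mod 2) \<le> 1" by simp
  have sqm1: "1 \<le> sqrt (real m)" using m by simp
  have "2 * real s \<le> \<bar>?k\<bar> + 1" using e1 by linarith
  also have "\<dots> \<le> R * sqrt (real m) + 1 * sqrt (real m)" using s(3) jm le sqm1 by linarith
  finally have s2: "2 * real s \<le> (R + 1) * sqrt (real m)" by (simp add: algebra_simps)
  have "2 * (2 * real s) \<le> (2 * (R + 1)) * sqrt (real m)" using s2 unfolding mult.assoc by linarith
  also have "\<dots> \<le> sqrt (real m) * sqrt (real m)" using sR sm by (intro mult_right_mono) auto
  finally have s4: "4 * s \<le> m" using sm by linarith
  let ?E = "- 2 * (real s ^ 2 - real (m mod 2) * real s) / (real m + 1)"
  have E: "?E = - (t\<^sup>2 / 2) + (t\<^sup>2 + real (m mod 2)) / (2 * (real m + 1))"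
    by (subst exponent_central[OF m _ refl]) (auto simp: t2)
  have "binom_ratio m j \<le> exp ?E"
    using central_binomial_upper[OF s(1)] c by (simp only: s(2) pos_divide_le_eq mult.commute)
  then have "ln (binom_ratio m j) \<le> ?E" using pos by (metis exp_le_cancel_iff exp_ln)
  moreover have "(t\<^sup>2 + real (m mod 2)) / (2 * (real m + 1)) \<le> (R + 1) ^ 4 / real m"
  proof (rule frac_le)
    have "1 * 1 \<le> (R + 1)\<^sup>2 * (R + 1)\<^sup>2" using R(1) by (intro mult_mono) auto
    have "t\<^sup>2 + real (m mod 2) \<le> (R + 1)\<^sup>2" using t2R e1 R(1) by (simp add: power2_eq_square algebra_simps)
    also have "\<dots> \<le> (R + 1) ^ 4" using R(1) by (intro power_increasing) auto
    finally show "t\<^sup>2 + real (m mod 2) \<le> (R + 1) ^ 4" .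
  qed (use m R(1) in auto)
  moreover have "binom_ratio m j \<ge> exp (?E - 16 * real s ^ 4 / (real m + 1) ^ 3)"
    using central_binomial_lower[OF s4] c by (simp only: s(2) pos_le_divide_eq mult.commute)
  then have "ln (binom_ratio m j) \<ge> ?E - 16 * real s ^ 4 / (real m + 1) ^ 3"
    using pos by (metis exp_le_cancel_iff exp_ln)
  moreover have "16 * real s ^ 4 / (real m + 1) ^ 3 \<le> (R + 1) ^ 4 / real m"
  proof -
    have "16 * real s ^ 4 = (2 * real s) ^ 4" by (simp add: power_mult_distrib)
    also have "\<dots> \<le> ((R + 1) * sqrt (real m)) ^ 4" using s2 by (intro power_mono) auto
    also have "\<dots> = (R + 1) ^ 4 * (real m)\<^sup>2"
      using sm by (simp add: power_mult_distrib eval_nat_numeral)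
    finally have "16 * real s ^ 4 / (real m + 1) ^ 3 \<le> (R + 1) ^ 4 * (real m)\<^sup>2 / (real m) ^ 3"
      using m R(1) by (intro frac_le power_mono) auto
    also have "\<dots> = (R + 1) ^ 4 / real m" using m by (simp add: eval_nat_numeral)
    finally show ?thesis .
  qed
  moreover have "(t\<^sup>2 + real (m mod 2)) / (2 * (real m + 1)) \<ge> 0" by simp
  ultimately show "\<bar>ln (binom_ratio m j) + t\<^sup>2 / 2\<bar> \<le> (R + 1) ^ 4 / real m"
    using E by linarith
qed

section \<open>The law of the group sums\<close>

text \<open>\<open>j l\<close> stands for the number of spins +1 in group \<open>l\<close>, so
  neighbouring points differ by 2 / sqrt (N l).\<close>

definition lattice_pt :: "('d::finite \<Rightarrow> nat) \<Rightarrow> ('d \<Rightarrow> int) \<Rightarrow> real^'d" where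
  "lattice_pt N j = (\<chi> l. (2 * real_of_int (j l) - real (N l)) / sqrt (real (N l)))"

definition up_counts :: "('d::finite \<Rightarrow> nat) \<Rightarrow> ('d \<times> nat \<Rightarrow> real) \<Rightarrow> 'd \<Rightarrow> int" where
  "up_counts N \<sigma> l = int (card {i \<in> {1..N l}. \<sigma> (l, i) = 1})"

text \<open>The matrix \<surd>\<alpha> J \<surd>\<alpha> with the proportions taken at finite
  size.\<close>

definition coupling :: "real^'d^'d \<Rightarrow> ('d::finite \<Rightarrow> nat) \<Rightarrow> real^'d^'d" where
  "coupling J N = (\<chi> l m. J $ l $ m * (sqrt (real (N l)) * sqrt (real (N m)) / real (\<Sum>k\<in>UNIV. N k)))"

text \<open>The probability of a lattice point up to a factor that does not depend on
  \<open>j\<close>.\<close>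

definition cw_profile :: "real^'d^'d \<Rightarrow> ('d::finite \<Rightarrow> nat) \<Rightarrow> ('d \<Rightarrow> int) \<Rightarrow> real" where
  "cw_profile J N j = (\<Prod>l\<in>UNIV. binom_ratio (N l) (j l)) *
     exp (lattice_pt N j \<bullet> (coupling J N *v lattice_pt N j) / 2)"

text \<open>Rounds \<open>y\<close> down to the lattice: the fibres are the half-open boxes with
  lower corner \<open>lattice_pt N j\<close> and sides 2 / sqrt (N l), which tile the space.\<close>

definition cell :: "('d::finite \<Rightarrow> nat) \<Rightarrow> real^'d \<Rightarrow> 'd \<Rightarrow> int" where
  "cell N y l = \<lfloor>(sqrt (real (N l)) * y $ l + real (N l)) / 2\<rfloor>"

section \<open>Counting configurations by their numbers of up spins\<close>

lemma spin_configs_value: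
  assumes "\<sigma> \<in> spin_configs N" "i \<in> {1..N l}"
  shows "\<sigma> (l, i) = 1 \<or> \<sigma> (l, i) = -1"
  using assms unfolding spin_configs_def by (auto dest!: PiE_mem[where x="(l, i)"])

lemma group_sum_eq:
  assumes "\<sigma> \<in> spin_configs N"
  shows "group_sum N \<sigma> l = 2 * real_of_int (up_counts N \<sigma> l) - real (N l)"
proof -
  have "group_sum N \<sigma> l = (\<Sum>i=1..N l. 2 * of_bool (\<sigma> (l, i) = 1) - 1)"
    unfolding group_sum_def using spin_configs_value[OF assms, of _ l] by (intro sum.cong) auto
  also have "\<dots> = 2 * (\<Sum>i=1..N l. of_bool (\<sigma> (l, i) = 1)) - real (N l)"
    by (simp add: sum_subtractf sum_distrib_left)
  also have "(\<Sum>i=1..N l. of_bool (\<sigma> (l, i) = 1)) = real (card {i \<in> {1..N l}. \<sigma> (l, i) = 1})"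
    by (simp add: Int_def)
  finally show ?thesis by (simp add: up_counts_def)
qed

lemma norm_sums_eq:
  "\<sigma> \<in> spin_configs N \<Longrightarrow> norm_sums N \<sigma> = lattice_pt N (up_counts N \<sigma>)"
  by (simp add: norm_sums_def lattice_pt_def group_sum_eq)

lemma sum_lattice_eq: "sum_lattice N = range (lattice_pt N)"
proof (intro equalityI subsetI)
  fix x assume "x \<in> sum_lattice N"
  then obtain k :: "'a \<Rightarrow> int" where k: "\<And>l. x $ l = (real (N l) + 2 * of_int (k l)) / sqrt (real (N l))"
    unfolding sum_lattice_def by (auto dest!: choice)
  have "x = lattice_pt N (\<lambda>l. int (N l) + k l)" by (simp add: vec_eq_iff lattice_pt_def k)
  then show "x \<in> range (lattice_pt N)" by blast
next
  fix x assume "x \<in> range (lattice_pt N)"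
  then obtain j where x: "x = lattice_pt N j" by blast
  have "\<exists>k::int. x $ l = (real (N l) + 2 * of_int k) / sqrt (real (N l))" for l
    by (intro exI[of _ "j l - int (N l)"]) (simp add: x lattice_pt_def)
  then show "x \<in> sum_lattice N" by (simp add: sum_lattice_def)
qed

lemma lattice_pt_eq_iff:
  assumes "\<And>l. N l > 0"
  shows "lattice_pt N i = lattice_pt N j \<longleftrightarrow> i = j"
  using assms by (auto simp: lattice_pt_def vec_eq_iff less_imp_neq[symmetric])

text \<open>The double sum over spins is a product of two group sums, so a configuration enters only
  through its normalised sums.\<close>

lemma cw_weight_eq:
  assumes "\<And>l. N l > 0"
  shows "cw_weight J N \<sigma> = exp (norm_sums N \<sigma> \<bullet> (coupling J N *v norm_sums N \<sigma>) / 2)"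
proof -
  define n where "n = real (\<Sum>k\<in>UNIV. N k)"
  have g: "group_sum N \<sigma> l = sqrt (real (N l)) * norm_sums N \<sigma> $ l" for l
    using assms[of l] by (simp add: norm_sums_def)
  have "(\<Sum>i=1..N l. \<Sum>j=1..N m. \<sigma> (l, i) * \<sigma> (m, j)) = group_sum N \<sigma> l * group_sum N \<sigma> m" for l m
    by (simp add: group_sum_def sum_product)
  then have "cw_weight J N \<sigma> = exp (1 / (2 * n) * (\<Sum>l\<in>UNIV. \<Sum>m\<in>UNIV. J $ l $ m * (group_sum N \<sigma> l * group_sum N \<sigma> m)))"
    by (simp add: cw_weight_def n_def)
  also have "1 / (2 * n) * (\<Sum>l\<in>UNIV. \<Sum>m\<in>UNIV. J $ l $ m * (group_sum N \<sigma> l * group_sum N \<sigma> m))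
    = norm_sums N \<sigma> \<bullet> (coupling J N *v norm_sums N \<sigma>) / 2"
    unfolding g coupling_def n_def[symmetric]
    by (simp add: inner_vec_def matrix_vector_mult_def sum_distrib_left sum_divide_distrib mult_ac)
  finally show ?thesis .
qed

text \<open>A configuration amounts to the choice of a set of up spins in each group.\<close>

lemma card_spin_configs_up_counts:
  fixes N :: "'d::finite \<Rightarrow> nat" and j :: "'d \<Rightarrow> nat"
  shows "card {\<sigma> \<in> spin_configs N. up_counts N \<sigma> = (\<lambda>l. int (j l))} = (\<Prod>l\<in>UNIV. N l choose j l)"
proof -
  let ?U = "\<lambda>\<sigma> l. {i \<in> {1..N l}. \<sigma> (l, i) = (1::real)}"
  \<comment> \<open>\<open>undefined\<close> off the index set matches the extensional functions in
    \<open>spin_configs\<close>; with another default \<open>?V (?U \<sigma>)\<close> would not be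
    \<sigma>.\<close>
  let ?V = "\<lambda>A (l, i). if i \<in> {1..N l} then if i \<in> A l then 1 else -1 else (undefined::real)"
  have "bij_betw ?U {\<sigma> \<in> spin_configs N. up_counts N \<sigma> = (\<lambda>l. int (j l))}
    (Pi\<^sub>E UNIV (\<lambda>l. {A. A \<subseteq> {1..N l} \<and> card A = j l}))"
  proof (rule bij_betwI[where g="?V"])
    show "?U \<in> {\<sigma> \<in> spin_configs N. up_counts N \<sigma> = (\<lambda>l. int (j l))} \<rightarrow>
      (Pi\<^sub>E UNIV (\<lambda>l. {A. A \<subseteq> {1..N l} \<and> card A = j l}))"
      by (auto simp: up_counts_def fun_eq_iff)
    have UV: "?U (?V A) = A" if "A \<in> Pi\<^sub>E UNIV (\<lambda>l. {A. A \<subseteq> {1..N l} \<and> card A = j l})" for A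
    proof
      fix l
      have "A l \<subseteq> {1..N l}" using that by (auto simp: PiE_iff)
      moreover have "?U (?V A) l = {i \<in> {1..N l}. i \<in> A l}" by (intro Collect_cong) auto
      ultimately show "?U (?V A) l = A l" by blast
    qed
    show "?V \<in> Pi\<^sub>E UNIV (\<lambda>l. {A. A \<subseteq> {1..N l} \<and> card A = j l}) \<rightarrow>
      {\<sigma> \<in> spin_configs N. up_counts N \<sigma> = (\<lambda>l. int (j l))}"
    proof
      fix A assume A: "A \<in> Pi\<^sub>E UNIV (\<lambda>l. {A. A \<subseteq> {1..N l} \<and> card A = j l})"
      have "?V A \<in> spin_configs N" by (auto simp: spin_configs_def PiE_iff extensional_def)
      moreover have "up_counts N (?V A) l = int (j l)" for l
        unfolding up_counts_def using fun_cong[OF UV[OF A], of l] A by (auto simp: PiE_iff)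
      ultimately show "?V A \<in> {\<sigma> \<in> spin_configs N. up_counts N \<sigma> = (\<lambda>l. int (j l))}" by auto
    qed
    show "?U (?V A) = A" if "A \<in> Pi\<^sub>E UNIV (\<lambda>l. {A. A \<subseteq> {1..N l} \<and> card A = j l})" for A
      by (rule UV[OF that])
    show "?V (?U \<sigma>) = \<sigma>" if \<sigma>: "\<sigma> \<in> {\<sigma> \<in> spin_configs N. up_counts N \<sigma> = (\<lambda>l. int (j l))}" for \<sigma>
    proof
      fix p :: "'d \<times> nat"
      obtain l i where p: "p = (l, i)" by (cases p)
      from \<sigma> have "i \<notin> {1..N l} \<Longrightarrow> \<sigma> (l, i) = undefined"
        unfolding spin_configs_def by (auto simp: PiE_iff extensional_def)
      with \<sigma> show "?V (?U \<sigma>) p = \<sigma> p" using spin_configs_value[of \<sigma> N i l] by (auto simp: p)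
    qed
  qed
  then have "card {\<sigma> \<in> spin_configs N. up_counts N \<sigma> = (\<lambda>l. int (j l))} =
    card (Pi\<^sub>E UNIV (\<lambda>l. {A. A \<subseteq> {1..N l} \<and> card A = j l}))"
    by (rule bij_betw_same_card)
  also have "\<dots> = (\<Prod>l\<in>UNIV. N l choose j l)" by (simp add: card_PiE n_subsets)
  finally show ?thesis .
qed

text \<open>The indicator keeps the range of summation independent of \<open>x\<close>, so that the
  sum can be integrated term by term when \<open>x\<close> varies with the cell.\<close>

lemma prob_norm_sums_eq_sum:
  "\<P>(\<sigma> in curie_weiss J N. norm_sums N \<sigma> = x) =
    (\<Sum>\<sigma>\<in>spin_configs N. cw_weight J N \<sigma> / cw_Z J N * of_bool (norm_sums N \<sigma> = x))"
proof -
  interpret prob_space "curie_weiss J N" by (rule prob_space_curie_weiss)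
  have sp: "space (curie_weiss J N) = spin_configs N"
    by (simp add: curie_weiss_def space_point_measure)
  have "prob {\<sigma> \<in> spin_configs N. norm_sums N \<sigma> = x} =
    (\<Sum>\<sigma>\<in>{\<sigma> \<in> spin_configs N. norm_sums N \<sigma> = x}. prob {\<sigma>})"
    by (rule finite_measure_eq_sum_singleton)
       (auto simp: finite_spin_configs curie_weiss_def sets_point_measure)
  also have "\<dots> = (\<Sum>\<sigma>\<in>{\<sigma> \<in> spin_configs N. norm_sums N \<sigma> = x}. cw_weight J N \<sigma> / cw_Z J N)"
    by (intro sum.cong) (auto simp: measure_curie_weiss_singleton)
  also have "\<dots> = (\<Sum>\<sigma>\<in>spin_configs N. cw_weight J N \<sigma> / cw_Z J N * of_bool (norm_sums N \<sigma> = x))"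
    by (intro sum.mono_neutral_cong_left) (auto simp: finite_spin_configs)
  finally show ?thesis by (simp add: sp)
qed

lemma prob_lattice_pt:
  fixes N :: "'d::finite \<Rightarrow> nat"
  assumes N: "\<And>l. N l > 0"
  shows "\<P>(\<sigma> in curie_weiss J N. norm_sums N \<sigma> = lattice_pt N j) =
    real (\<Prod>l\<in>UNIV. N l choose (N l div 2)) / cw_Z J N * cw_profile J N j"
proof -
  let ?S = "{\<sigma> \<in> spin_configs N. up_counts N \<sigma> = j}"
  let ?x = "lattice_pt N j"
  have "\<P>(\<sigma> in curie_weiss J N. norm_sums N \<sigma> = ?x) =
    (\<Sum>\<sigma>\<in>?S. exp (?x \<bullet> (coupling J N *v ?x) / 2) / cw_Z J N)"
    unfolding prob_norm_sums_eq_sum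
    by (intro sum.mono_neutral_cong_right)
       (auto simp: finite_spin_configs norm_sums_eq lattice_pt_eq_iff[OF N] cw_weight_eq[OF N])
  also have "\<dots> = real (card ?S) * exp (?x \<bullet> (coupling J N *v ?x) / 2) / cw_Z J N" by simp
  \<comment> \<open>This covers unattainable \<open>j\<close> too, where both sides are 0.\<close>
  also have "real (card ?S) = (\<Prod>l\<in>UNIV. real (N l choose (N l div 2)) * binom_ratio (N l) (j l))"
  proof (cases "\<forall>l. j l \<ge> 0")
    case True
    then have "j = (\<lambda>l. int (nat (j l)))" by auto
    then have "card ?S = (\<Prod>l\<in>UNIV. N l choose nat (j l))"
      using card_spin_configs_up_counts[of N "\<lambda>l. nat (j l)"] by simp
    moreover have "real (N l choose (N l div 2)) * binom_ratio (N l) (j l) = real (N l choose nat (j l))" for l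
      using True by (auto simp: binom_ratio_def not_less)
    ultimately show ?thesis by simp
  next
    case False
    then obtain l where l: "j l < 0" by (auto simp: not_le)
    then have "?S = {}" by (auto simp: up_counts_def)
    then have "card ?S = 0" by (simp only: card.empty)
    moreover have "binom_ratio (N l) (j l) = 0" using l by (simp add: binom_ratio_def)
    then have "(\<Prod>l\<in>UNIV. real (N l choose (N l div 2)) * binom_ratio (N l) (j l)) = 0"
      by (auto simp: prod_zero_iff)
    ultimately show ?thesis by (simp only: of_nat_0)
  qed
  finally show ?thesis by (simp add: cw_profile_def prod.distrib)
qed

section \<open>Lattice cells and their volume\<close>

lemma lattice_pt_cell:
  assumes "N l > 0"
  shows "lattice_pt N (cell N y) $ l \<le> y $ l" "y $ l < lattice_pt N (cell N y) $ l + 2 / sqrt (real (N l))"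
proof -
  have s: "sqrt (real (N l)) > 0" using assms by simp
  have "real_of_int (cell N y l) \<le> (sqrt (real (N l)) * y $ l + real (N l)) / 2"
    "(sqrt (real (N l)) * y $ l + real (N l)) / 2 < real_of_int (cell N y l) + 1"
    unfolding cell_def by linarith+
  then show "lattice_pt N (cell N y) $ l \<le> y $ l" "y $ l < lattice_pt N (cell N y) $ l + 2 / sqrt (real (N l))"
    using s by (simp_all add: lattice_pt_def field_simps)
qed

lemma cell_eq_iff:
  assumes N: "\<And>l. N l > 0"
  shows "cell N y = j \<longleftrightarrow> (\<forall>l. lattice_pt N j $ l \<le> y $ l \<and> y $ l < lattice_pt N j $ l + 2 / sqrt (real (N l)))"
proof -
  have "cell N y l = j l \<longleftrightarrow> lattice_pt N j $ l \<le> y $ l \<and> y $ l < lattice_pt N j $ l + 2 / sqrt (real (N l))" for l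
  proof -
    have s: "sqrt (real (N l)) > 0" using N by simp
    show ?thesis unfolding cell_def floor_eq_iff using s
      by (simp add: lattice_pt_def field_simps)
  qed
  then show ?thesis by (auto simp: fun_eq_iff)
qed

lemma cell_measurable [measurable]: "{y. cell N y = j} \<in> sets borel"
  unfolding fun_eq_iff cell_def by measurable

text \<open>The half-open cell is squeezed between an open and a closed box of the same
  volume.\<close>

lemma emeasure_cell:
  fixes N :: "'d::finite \<Rightarrow> nat"
  assumes N: "\<And>l. N l > 0"
  shows "emeasure lborel {y. cell N y = j} = ennreal (\<Prod>l\<in>UNIV. 2 / sqrt (real (N l)))"
proof -
  let ?a = "lattice_pt N j" and ?b = "lattice_pt N j + (\<chi> l. 2 / sqrt (real (N l)))"
  have basis: "Basis = range (\<lambda>i. axis i (1::real) :: real^'d)" by (auto simp: Basis_vec_def)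
  have le: "?a \<bullet> b \<le> ?b \<bullet> b" if "b \<in> Basis" for b using that by (auto simp: basis inner_axis)
  have v: "(\<Prod>b\<in>Basis. (?b - ?a) \<bullet> b) = (\<Prod>l\<in>UNIV. 2 / sqrt (real (N l)))"
    by (simp add: basis prod.reindex inj_on_def axis_eq_axis inner_axis)
  have "box ?a ?b \<subseteq> {y. cell N y = j}" "{y. cell N y = j} \<subseteq> cbox ?a ?b"
    by (auto simp: cell_eq_iff[OF N] mem_box_cart less_imp_le)
  then have "emeasure lborel (box ?a ?b) \<le> emeasure lborel {y. cell N y = j}"
    "emeasure lborel {y. cell N y = j} \<le> emeasure lborel (cbox ?a ?b)"
    by (auto intro!: emeasure_mono)
  then show ?thesis using emeasure_lborel_box[OF le] emeasure_lborel_cbox[OF le] v by simp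
qed

text \<open>The prefactor is the reciprocal of the cell volume, so the step function integrates to
  the total probability. Summing over configurations, rather than over the infinitely many cells,
  keeps the sum finite.\<close>

lemma integral_prob_cell:
  fixes N :: "'d::finite \<Rightarrow> nat"
  assumes N: "\<And>l. N l > 0"
  shows "has_bochner_integral lborel (\<lambda>y. (\<Prod>l\<in>UNIV. sqrt (real (N l))) / 2 ^ CARD('d) *
    \<P>(\<sigma> in curie_weiss J N. norm_sums N \<sigma> = lattice_pt N (cell N y))) 1"
proof -
  let ?c = "(\<Prod>l\<in>UNIV. sqrt (real (N l))) / 2 ^ CARD('d)"
  let ?v = "\<Prod>l\<in>UNIV. 2 / sqrt (real (N l))"
  have cv: "?c * ?v = 1"
    using N by (simp add: prod_dividef less_imp_neq[symmetric])
  have "has_bochner_integral lborel (indicat_real {y. cell N y = j}) ?v" for j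
    using emeasure_cell[OF N, where j = j] has_bochner_integral_real_indicator[where A = "{y. cell N y = j}" and M = lborel]
    by (simp add: measure_def prod_nonneg)
  then have "has_bochner_integral lborel
    (\<lambda>y. \<Sum>\<sigma>\<in>spin_configs N. ?c * (cw_weight J N \<sigma> / cw_Z J N) * indicat_real {y. cell N y = up_counts N \<sigma>} y)
    (\<Sum>\<sigma>\<in>spin_configs N. ?c * (cw_weight J N \<sigma> / cw_Z J N) * ?v)"
    by (intro has_bochner_integral_sum has_bochner_integral_mult_right)
  moreover have "(\<Sum>\<sigma>\<in>spin_configs N. ?c * (cw_weight J N \<sigma> / cw_Z J N) * indicat_real {y. cell N y = up_counts N \<sigma>} y)
    = ?c * \<P>(\<sigma> in curie_weiss J N. norm_sums N \<sigma> = lattice_pt N (cell N y))" for y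
    unfolding prob_norm_sums_eq_sum sum_distrib_left
    by (intro sum.cong refl) (auto simp: norm_sums_eq lattice_pt_eq_iff[OF N] indicator_def)
  moreover have "(\<Sum>\<sigma>\<in>spin_configs N. ?c * (cw_weight J N \<sigma> / cw_Z J N) * ?v) = 1"
  proof -
    have "?c * (cw_weight J N \<sigma> / cw_Z J N) * ?v = cw_weight J N \<sigma> / cw_Z J N" for \<sigma>
    proof -
      have "?c * w * ?v = (?c * ?v) * w" for w by (simp only: mult_ac)
      then show ?thesis by (simp only: cv mult_1)
    qed
    then have "(\<Sum>\<sigma>\<in>spin_configs N. ?c * (cw_weight J N \<sigma> / cw_Z J N) * ?v) = (\<Sum>\<sigma>\<in>spin_configs N. cw_weight J N \<sigma> / cw_Z J N)"
      by simp
    also have "\<dots> = 1" using cw_Z_pos[of J N] by (simp add: cw_Z_def flip: sum_divide_distrib)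
    finally show ?thesis .
  qed
  ultimately show ?thesis by simp
qed

section \<open>Covariance matrices\<close>

lemma diag_mat_mult: "diag_mat v ** diag_mat w = diag_mat (\<chi> i. v $ i * w $ i)"
proof -
  have "(\<Sum>k\<in>UNIV. (if i = k then v $ i else 0) * (if k = j then w $ k else 0)) =
    (\<Sum>k\<in>UNIV. if k = i then (if i = j then v $ i * w $ i else 0) else 0)" for i j
    by (intro sum.cong) auto
  then show ?thesis by (simp add: diag_mat_def matrix_matrix_mult_def vec_eq_iff)
qed

lemma transpose_diag_mat [simp]: "transpose (diag_mat v) = diag_mat v"
  by (auto simp: diag_mat_def transpose_def vec_eq_iff)

lemma transpose_const_mat [simp]: "transpose (const_mat b) = const_mat b"
  by (simp add: const_mat_def transpose_def vec_eq_iff)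

lemma diag_conj_component:
  "(diag_mat v ** M ** diag_mat v) $ i $ j = v $ i * M $ i $ j * v $ j"
  by (simp add: diag_mat_def matrix_matrix_mult_def if_distrib[of "\<lambda>x. x * _"] if_distrib[of "\<lambda>x. _ * x"] cong: if_cong)

lemma const_mat_diag_const_mat:
  "const_mat s ** diag_mat \<alpha> ** const_mat b = const_mat (s * (\<Sum>i\<in>UNIV. \<alpha> $ i) * b)"
  by (simp add: const_mat_def diag_mat_def matrix_matrix_mult_def vec_eq_iff if_distrib sum_distrib_left sum_distrib_right cong: if_cong)

lemma quad_form_const_mat:
  "x \<bullet> (const_mat s *v x) = s * (\<Sum>i\<in>UNIV. x $ i)\<^sup>2"
  by (simp add: const_mat_def matrix_vector_mult_def inner_vec_def power2_eq_square
    sum_distrib_left sum_distrib_right mult_ac)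

lemma transpose_add: "transpose (A + B) = transpose A + transpose B"
  by (simp add: transpose_def vec_eq_iff)

lemma transpose_diff: "transpose (A - B) = transpose A - transpose (B :: 'a::ab_group_add^'n^'m)"
  by (simp add: transpose_def vec_eq_iff)

lemma matrix_mult_diff_distrib:
  "A ** (B - C) = A ** B - A ** (C :: 'a::ring_1^'n^'m)"
  by (simp add: matrix_matrix_mult_def vec_eq_iff right_diff_distrib sum_subtractf)

lemma matrix_mult_diff_rdistrib:
  "(A - B) ** C = A ** C - B ** (C :: 'a::ring_1^'n^'m)"
  by (simp add: matrix_matrix_mult_def vec_eq_iff left_diff_distrib sum_subtractf)

lemma matrix_mult_add_rdistrib:
  "(A + B) ** C = A ** C + B ** (C :: 'a::ring_1^'n^'m)"
  by (simp add: matrix_matrix_mult_def vec_eq_iff distrib_right sum.distrib)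

lemma matrix_inv_eqI:
  fixes A B :: "'a::semiring_1^'n^'n"
  assumes "A ** B = mat 1" "B ** A = mat 1"
  shows "matrix_inv A = B"
  unfolding matrix_inv_def
proof (rule some_equality)
  fix X assume "A ** X = mat 1 \<and> X ** A = mat 1"
  then show "X = B" using assms by (metis matrix_mul_assoc matrix_mul_lid matrix_mul_rid)
qed (use assms in auto)

text \<open>As \<open>x = C *v (Q *v x)\<close>, the form of \<open>Q\<close> at \<open>x\<close> is
  the form of \<open>C\<close> at \<open>Q *v x\<close>.\<close>

lemma pos_def_from_left_inverse:
  fixes C Q :: "real^'n^'n"
  assumes C: "pos_def C" and CQ: "C ** Q = mat 1" and Q: "transpose Q = Q"
  shows "pos_def Q"
  unfolding pos_def_def
proof (intro conjI allI impI Q)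
  fix x :: "real^'n" assume "x \<noteq> 0"
  have *: "C *v (Q *v x) = x" by (simp add: matrix_vector_mul_assoc CQ)
  with \<open>x \<noteq> 0\<close> have "Q *v x \<noteq> 0" by (metis matrix_vector_mult_0_right)
  with C have "0 < (Q *v x) \<bullet> (C *v (Q *v x))" by (simp add: pos_def_def)
  then show "0 < x \<bullet> (Q *v x)" by (simp add: * inner_commute)
qed

lemma pos_def_matrix_inv:
  fixes M :: "real^'n^'n"
  assumes "pos_def M"
  shows "matrix_inv M ** M = mat 1" "M ** matrix_inv M = mat 1" "pos_def (matrix_inv M)"
proof -
  have "invertible M" using pos_def_det_pos[OF assms] by (simp add: invertible_det_nz)
  then obtain B where "M ** B = mat 1" "B ** M = mat 1" by (auto simp: invertible_def)
  then show inv: "matrix_inv M ** M = mat 1" "M ** matrix_inv M = mat 1"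
    by (simp_all add: matrix_inv_eqI[of M B])
  have "transpose (matrix_inv M) ** M = mat 1"
    using arg_cong[OF inv(2), of transpose] assms by (simp add: matrix_transpose_mul pos_def_def)
  then have "transpose (matrix_inv M) = matrix_inv M"
    by (metis inv(2) matrix_mul_assoc matrix_mul_lid matrix_mul_rid)
  with pos_def_from_left_inverse[OF assms inv(2)] show "pos_def (matrix_inv M)" .
qed

text \<open>The identity supplies definiteness, so \<open>S\<close> may be merely semidefinite, as
  the constant matrices of the homogeneous case are.\<close>

lemma cov_mat_pos_def:
  fixes S :: "real^'n^'n"
  assumes "transpose S = S" "\<And>x. 0 \<le> x \<bullet> (S *v x)"
  shows "pos_def (cov_mat \<alpha> S)"
  unfolding pos_def_def
proof (intro conjI allI impI)
  let ?D = "diag_mat (\<chi> i. sqrt (\<alpha> $ i)) :: real^'n^'n"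
  show "transpose (cov_mat \<alpha> S) = cov_mat \<alpha> S"
    by (simp add: cov_mat_def transpose_add matrix_transpose_mul matrix_mul_assoc assms(1))
  fix x :: "real^'n" assume "x \<noteq> 0"
  have "x \<bullet> ((?D ** S ** ?D) *v x) = (?D *v x) \<bullet> (S *v (?D *v x))"
    by (simp only: matrix_vector_mul_assoc[symmetric] inner_matrix_sym[OF transpose_diag_mat, of x]) (rule inner_commute)
  then have "x \<bullet> (cov_mat \<alpha> S *v x) = x \<bullet> x + (?D *v x) \<bullet> (S *v (?D *v x))"
    by (simp add: cov_mat_def matrix_vector_mult_add_rdistrib inner_simps)
  also have "\<dots> > 0" using \<open>x \<noteq> 0\<close> assms(2)[of "?D *v x"] by (intro add_pos_nonneg) auto
  finally show "0 < x \<bullet> (cov_mat \<alpha> S *v x)" .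
qed

text \<open>The Woodbury identity; the hypothesis \<open>SJ\<close> holds for homogeneous and heterogeneous couplings alike.\<close>

lemma cov_mat_inverse:
  fixes S J :: "real^'n^'n"
  assumes \<alpha>: "\<And>i. \<alpha> $ i \<ge> 0" and SJ: "S - S ** diag_mat \<alpha> ** J = J"
  defines "D \<equiv> diag_mat (\<chi> i. sqrt (\<alpha> $ i))"
  shows "cov_mat \<alpha> S ** (mat 1 - D ** J ** D) = mat 1"
proof -
  have DD: "D ** D = diag_mat \<alpha>"
    using \<alpha> by (simp add: D_def diag_mat_mult)
  have "(D ** S ** D) ** (D ** J ** D) = D ** (S ** (D ** D) ** J) ** D"
    by (simp add: matrix_mul_assoc)
  also have "\<dots> = D ** (S - J) ** D" unfolding DD using SJ by (metis diff_diff_eq2 add_diff_cancel_left' diff_add_cancel)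
  finally have "(D ** S ** D) ** (D ** J ** D) = D ** S ** D - D ** J ** D"
    by (simp add: matrix_mult_diff_distrib matrix_mult_diff_rdistrib)
  then show ?thesis
    by (simp add: cov_mat_def D_def[symmetric] matrix_mult_diff_distrib matrix_mult_add_rdistrib)
qed

text \<open>\<Sigma> is formally the series J + J \<alpha> J + J \<alpha> J \<alpha> J + ....
  Between constant matrices \<alpha> acts as the scalar 1, because its entries sum to 1, and the
  identity is that of a geometric series; in the heterogeneous case it is \<Sigma> H = I multiplied
  by J.\<close>

lemma high_temp_resolvent:
  fixes J \<Sigma> :: "real^'d^'d"
  assumes \<alpha>: "(\<Sum>i\<in>UNIV. \<alpha> $ i) = 1" and high_temp:
      "(homogeneous \<beta> J \<and> \<beta> < 1 \<and> \<Sigma> = const_mat (\<beta> / (1 - \<beta>))) \<or>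
       (heterogeneous J \<and> pos_def (H_mat \<alpha> J) \<and> \<Sigma> = matrix_inv (H_mat \<alpha> J))"
  shows "\<Sigma> - \<Sigma> ** diag_mat \<alpha> ** J = J" "transpose J = J" "transpose \<Sigma> = \<Sigma>" "0 \<le> x \<bullet> (\<Sigma> *v x)"
proof -
  have "\<Sigma> - \<Sigma> ** diag_mat \<alpha> ** J = J \<and> transpose J = J \<and> transpose \<Sigma> = \<Sigma> \<and> 0 \<le> x \<bullet> (\<Sigma> *v x)"
    using high_temp
  proof (elim disjE conjE)
    assume J: "homogeneous \<beta> J" and \<beta>: "\<beta> < 1" and S: "\<Sigma> = const_mat (\<beta> / (1 - \<beta>))"
    have "\<beta> / (1 - \<beta>) - \<beta> / (1 - \<beta>) * \<beta> = \<beta>"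
    proof -
      have "\<beta> / (1 - \<beta>) * (1 - \<beta>) = \<beta>" using \<beta> by simp
      then show ?thesis by (simp only: right_diff_distrib mult_1_right)
    qed
    then have "const_mat (\<beta> / (1 - \<beta>)) - const_mat (\<beta> / (1 - \<beta>) * 1 * \<beta>) = (const_mat \<beta> :: real^'d^'d)"
      by (simp add: const_mat_def vec_eq_iff)
    then show ?thesis using J \<beta> unfolding homogeneous_def S
      by (auto simp: const_mat_diag_const_mat \<alpha> quad_form_const_mat)
  next
    assume J: "heterogeneous J" and H: "pos_def (H_mat \<alpha> J)" and S: "\<Sigma> = matrix_inv (H_mat \<alpha> J)"
    have J: "pos_def J" using J by (simp add: heterogeneous_def)
    have "\<Sigma> ** (matrix_inv J - diag_mat \<alpha>) ** J = J"
      using pos_def_matrix_inv(1)[OF H] by (simp add: S H_mat_def)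
    then have "\<Sigma> ** (matrix_inv J ** J) - \<Sigma> ** diag_mat \<alpha> ** J = J"
      by (simp add: matrix_mult_diff_distrib matrix_mult_diff_rdistrib matrix_mul_assoc)
    then have "\<Sigma> - \<Sigma> ** diag_mat \<alpha> ** J = J"
      by (simp add: pos_def_matrix_inv(1)[OF J])
    moreover have "pos_def \<Sigma>" using pos_def_matrix_inv(3)[OF H] by (simp add: S)
    moreover from this have "0 \<le> x \<bullet> (\<Sigma> *v x)" by (cases "x = 0") (auto simp: pos_def_def less_imp_le)
    ultimately show ?thesis using J by (simp add: pos_def_def)
  qed
  then show "\<Sigma> - \<Sigma> ** diag_mat \<alpha> ** J = J" "transpose J = J" "transpose \<Sigma> = \<Sigma>" "0 \<le> x \<bullet> (\<Sigma> *v x)"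
    by auto
qed

lemma normal_density_mat_inverse:
  fixes C Q :: "real^'n^'n"
  assumes "C ** Q = mat 1" "pos_def Q"
  shows "normal_density_mat C x = exp (- (x \<bullet> (Q *v x)) / 2) / sqrt ((2 * pi) ^ CARD('n) / det Q)"
proof -
  have "Q ** C = mat 1" using assms(1) matrix_left_right_inverse by blast
  then have "matrix_inv C = Q" using assms(1) by (metis matrix_inv_eqI)
  moreover have "det C = 1 / det Q"
    using arg_cong[OF assms(1), of det] pos_def_det_pos[OF assms(2)] by (simp add: det_mul field_simps)
  ultimately show ?thesis by (simp add: normal_density_mat_def)
qed

text \<open>\<open>c\<close> is the minimum over the unit sphere, attained by compactness;
  homogeneity of degree 2 does the rest.\<close>

lemma pos_def_coercive:
  fixes Q :: "real^'n^'n"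
  assumes "pos_def Q"
  obtains c where "c > 0" "\<And>x. c * (x \<bullet> x) \<le> x \<bullet> (Q *v x)"
proof -
  let ?S = "sphere (0 :: real^'n) 1"
  have cont: "continuous_on ?S (\<lambda>x. x \<bullet> (Q *v x))"
    by (intro continuous_intros matrix_vector_mult_linear_continuous_on)
  have "axis undefined 1 \<in> ?S" by simp
  then have "?S \<noteq> {}" by blast
  from continuous_attains_inf[OF compact_sphere this cont]
  obtain u where u: "u \<in> ?S" "\<And>x. x \<in> ?S \<Longrightarrow> u \<bullet> (Q *v u) \<le> x \<bullet> (Q *v x)" by auto
  show ?thesis
  proof
    show "u \<bullet> (Q *v u) > 0"
    proof -
      have "u \<noteq> 0" using u(1) by auto
      then show ?thesis using assms by (simp add: pos_def_def)
    qed
    fix x :: "real^'n"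
    show "u \<bullet> (Q *v u) * (x \<bullet> x) \<le> x \<bullet> (Q *v x)"
    proof (cases "x = 0")
      case False
      define r where "r = norm x"
      define z where "z = (1 / r) *\<^sub>R x"
      have r: "r > 0" "x \<bullet> x = r * r" using False by (simp_all add: r_def power2_norm_eq_inner[symmetric] power2_eq_square)
      have "z \<in> ?S" "x = r *\<^sub>R z" using r(1) by (simp_all add: z_def r_def)
      then have "u \<bullet> (Q *v u) * (r * r) \<le> z \<bullet> (Q *v z) * (r * r)" using u(2) by (intro mult_right_mono) auto
      also have "\<dots> = x \<bullet> (Q *v x)" by (simp add: \<open>x = r *\<^sub>R z\<close> matrix_vector_mult_scaleR)
      finally show ?thesis by (simp add: r(2))
    qed simp
  qed
qed

section \<open>The limit\<close>

lemma abs_bilinear_le: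
  fixes M :: "real^'n^'n"
  shows "\<bar>x \<bullet> (M *v x)\<bar> \<le> (\<Sum>l\<in>UNIV. \<Sum>m\<in>UNIV. \<bar>M $ l $ m\<bar>) * (x \<bullet> x)"
proof -
  have c: "\<bar>x $ l\<bar> * \<bar>x $ m\<bar> \<le> x \<bullet> x" for l m
  proof -
    have "\<bar>x $ l\<bar> * \<bar>x $ m\<bar> \<le> norm x * norm x"
      using component_le_norm_cart[of x] by (intro mult_mono) auto
    then show ?thesis by (simp add: power2_norm_eq_inner[symmetric] power2_eq_square)
  qed
  have "\<bar>x \<bullet> (M *v x)\<bar> = \<bar>\<Sum>l\<in>UNIV. \<Sum>m\<in>UNIV. M $ l $ m * (x $ l * x $ m)\<bar>"
    by (simp add: inner_vec_def matrix_vector_mult_def sum_distrib_left mult_ac)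
  also have "\<dots> \<le> (\<Sum>l\<in>UNIV. \<Sum>m\<in>UNIV. \<bar>M $ l $ m\<bar> * (\<bar>x $ l\<bar> * \<bar>x $ m\<bar>))"
    by (intro order_trans[OF sum_abs] sum_mono) (simp add: abs_mult)
  also have "\<dots> \<le> (\<Sum>l\<in>UNIV. \<Sum>m\<in>UNIV. \<bar>M $ l $ m\<bar> * (x \<bullet> x))"
    by (intro sum_mono mult_left_mono c) auto
  finally show ?thesis by (simp add: sum_distrib_right)
qed

lemma cw_profile_nonneg: "cw_profile J N j \<ge> 0"
  unfolding cw_profile_def by (intro mult_nonneg_nonneg prod_nonneg binom_ratio_nonneg ballI) auto

text \<open>One factor \<open>exp 1\<close> per group; the quadratic exponent is kept without
  loss.\<close>

lemma cw_profile_upper: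
  fixes N :: "'d::finite \<Rightarrow> nat" and j :: "'d \<Rightarrow> int"
  assumes N: "\<And>l. N l > 0"
  defines "x \<equiv> lattice_pt N j"
  shows "cw_profile J N j \<le> exp (real CARD('d)) * exp (- (x \<bullet> x) / 2 + x \<bullet> (coupling J N *v x) / 2)"
proof -
  have "(\<Prod>l\<in>UNIV. binom_ratio (N l) (j l)) \<le> (\<Prod>l\<in>UNIV. exp 1 * exp (- (x $ l)\<^sup>2 / 2))"
    using binom_ratio_upper[OF N] by (intro prod_mono) (auto simp: binom_ratio_nonneg x_def lattice_pt_def)
  also have "\<dots> = exp (real CARD('d)) * exp (- (x \<bullet> x) / 2)"
    by (simp add: prod.distrib exp_sum[symmetric] exp_of_nat_mult[symmetric] inner_vec_def power2_eq_square
      sum_divide_distrib sum_negf)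
  finally have "cw_profile J N j \<le> exp (real CARD('d)) * exp (- (x \<bullet> x) / 2) * exp (x \<bullet> (coupling J N *v x) / 2)"
    unfolding cw_profile_def x_def by (intro mult_right_mono) auto
  then show ?thesis by (simp only: exp_add mult.assoc)
qed

text \<open>Passes from an error in the logarithm to an absolute one: \<open>exp b \<le> 1\<close>,
  and 1 - exp (-h) \<le> h \<le> exp h - 1 gives the same bound for both signs of
  \<open>a - b\<close>.\<close>

lemma abs_exp_diff_le:
  fixes a b :: real
  assumes "b \<le> 0" "\<bar>a - b\<bar> \<le> e"
  shows "\<bar>exp a - exp b\<bar> \<le> exp e - 1"
proof -
  have "\<bar>exp a - exp b\<bar> = exp b * \<bar>exp (a - b) - 1\<bar>"
  proof -
    have "exp a - exp b = exp b * (exp (a - b) - 1)" by (simp add: exp_diff right_diff_distrib)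
    then show ?thesis by (simp add: abs_mult)
  qed
  also have "\<dots> \<le> 1 * \<bar>exp (a - b) - 1\<bar>" using assms(1) by (intro mult_right_mono) auto
  also have "\<bar>exp (a - b) - 1\<bar> \<le> exp e - 1"
  proof (cases "a \<ge> b")
    case True
    then show ?thesis using assms(2) by auto
  next
    case False
    have "1 - exp (- (b - a)) \<le> b - a" using exp_ge_add_one_self[of "-(b - a)"] by linarith
    also have "\<dots> \<le> exp (b - a) - 1" using exp_ge_add_one_self[of "b - a"] by linarith
    also have "\<dots> \<le> exp e - 1" using assms(2) by simp
    finally show ?thesis using False by simp
  qed
  finally show ?thesis by simp
qed

lemma pos_def_scaleR_mat_1: "c > 0 \<Longrightarrow> pos_def (c *\<^sub>R mat 1)"
  by (simp add: pos_def_def transpose_scalar scaleR_matrix_vector_assoc[symmetric])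

text \<open>Isolates what the limit uses: the two classes of couplings enter only through the limit
  of the finite-size couplings and the definiteness of \<open>Q\<close>.\<close>

locale curie_weiss_limit =
  fixes N :: "nat \<Rightarrow> 'd::finite \<Rightarrow> nat" and J A Q :: "real^'d^'d"
  assumes N_lim: "\<And>l. filterlim (\<lambda>n. N n l) at_top sequentially"
    and coupling_lim: "\<And>l m. (\<lambda>n. coupling J (N n) $ l $ m) \<longlonglongrightarrow> A $ l $ m"
    and Q_eq: "Q = mat 1 - A" and Q_pos_def: "pos_def Q"
begin

definition gap :: "nat \<Rightarrow> real" where
  "gap n = (\<Sum>l\<in>UNIV. \<Sum>m\<in>UNIV. \<bar>(coupling J (N n) - A) $ l $ m\<bar>)"

definition gauss :: "real^'d \<Rightarrow> real" where
  "gauss x = exp (- (x \<bullet> (Q *v x)) / 2)"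

definition gauss_mass :: real where
  "gauss_mass = sqrt ((2 * pi) ^ CARD('d) / det Q)"

lemma gauss_mass_pos: "gauss_mass > 0"
  unfolding gauss_mass_def using pos_def_det_pos[OF Q_pos_def] by auto

lemma Q_nonneg: "x \<bullet> (Q *v x) \<ge> 0"
  using Q_pos_def by (cases "x = 0") (auto simp: pos_def_def less_imp_le)

lemma gauss_le_1: "gauss x \<le> 1"
  using Q_nonneg[of x] by (simp add: gauss_def)

lemma gauss_nonneg: "gauss x \<ge> 0"
  by (simp add: gauss_def)

lemma Q_form: "x \<bullet> (Q *v x) = x \<bullet> x - x \<bullet> (A *v x)"
  by (simp add: Q_eq matrix_vector_mult_diff_rdistrib inner_simps)

lemma N_ge: "\<forall>\<^sub>F n in sequentially. \<forall>l. N n l \<ge> k"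
  using N_lim by (auto simp: filterlim_at_top intro!: eventually_all_finite)

lemma N_pos: "\<forall>\<^sub>F n in sequentially. \<forall>l. N n l > 0"
  using N_ge[of 1] by eventually_elim (simp add: Suc_le_eq)

lemma real_N_lim: "filterlim (\<lambda>n. real (N n l)) at_top sequentially"
  by (rule filterlim_compose[OF filterlim_real_sequentially N_lim])

lemma gap_lim: "gap \<longlonglongrightarrow> 0"
proof -
  have "(\<lambda>n. \<Sum>l\<in>UNIV. \<Sum>m\<in>UNIV. \<bar>coupling J (N n) $ l $ m - A $ l $ m\<bar>) \<longlonglongrightarrow>
    (\<Sum>l\<in>UNIV. \<Sum>m\<in>UNIV. \<bar>A $ l $ m - A $ l $ m\<bar>)"
    by (intro tendsto_intros coupling_lim)
  then show ?thesis by (simp add: gap_def[abs_def])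
qed

lemma coupling_form_le:
  "\<bar>x \<bullet> (coupling J (N n) *v x) - x \<bullet> (A *v x)\<bar> \<le> gap n * (x \<bullet> x)"
  using abs_bilinear_le[of x "coupling J (N n) - A"]
  by (simp add: gap_def matrix_vector_mult_diff_rdistrib inner_simps)

text \<open>Once \<open>gap n\<close> is below half the coercivity constant of \<open>Q\<close>, the
  exponent is at most -(c - c/2) / 2 times \<open>x \<bullet> x\<close>, whence the rate c/4. The
  limit decays at rate c/2 and fits under the same bound.\<close>

lemma profile_dominated:
  obtains K c where "K > 0" "c > 0"
    "\<forall>\<^sub>F n in sequentially. \<forall>j. cw_profile J (N n) j \<le> K * exp (- c * (lattice_pt (N n) j \<bullet> lattice_pt (N n) j))"
    "\<And>x. gauss x \<le> K * exp (- c * (x \<bullet> x))"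
proof -
  obtain c where c: "c > 0" "\<And>x. c * (x \<bullet> x) \<le> x \<bullet> (Q *v x)"
    using pos_def_coercive[OF Q_pos_def] by auto
  let ?K = "exp (real CARD('d))"
  show ?thesis
  proof (rule that[of ?K "c / 4"])
    have "\<forall>\<^sub>F n in sequentially. gap n < c / 2"
      using c(1) by (intro order_tendstoD[OF gap_lim]) auto
    with N_pos show "\<forall>\<^sub>F n in sequentially. \<forall>j. cw_profile J (N n) j \<le>
      ?K * exp (- (c / 4) * (lattice_pt (N n) j \<bullet> lattice_pt (N n) j))"
    proof eventually_elim
      case (elim n)
      show ?case
      proof
        fix j
        let ?x = "lattice_pt (N n) j"
        have "gap n * (?x \<bullet> ?x) \<le> c / 2 * (?x \<bullet> ?x)" using elim by (intro mult_right_mono) auto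
        then have "- (?x \<bullet> ?x) / 2 + ?x \<bullet> (coupling J (N n) *v ?x) / 2 \<le> - (c / 4) * (?x \<bullet> ?x)"
          using coupling_form_le[of ?x n] c(2)[of ?x] Q_form[of ?x] by (simp add: abs_le_iff)
        then have "?K * exp (- (?x \<bullet> ?x) / 2 + ?x \<bullet> (coupling J (N n) *v ?x) / 2) \<le> ?K * exp (- (c / 4) * (?x \<bullet> ?x))"
          by (intro mult_left_mono) auto
        from order_trans[OF cw_profile_upper this] elim
        show "cw_profile J (N n) j \<le> ?K * exp (- (c / 4) * (?x \<bullet> ?x))" by blast
      qed
    qed
    fix x :: "real^'d"
    have "c * (x \<bullet> x) \<ge> 0" using c(1) by simp
    then have "gauss x \<le> 1 * exp (- (c / 4) * (x \<bullet> x))"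
      using c(2)[of x] by (simp add: gauss_def)
    also have "\<dots> \<le> ?K * exp (- (c / 4) * (x \<bullet> x))" by (intro mult_right_mono) auto
    finally show "gauss x \<le> ?K * exp (- (c / 4) * (x \<bullet> x))" .
  qed (use c(1) in auto)
qed

lemma profile_locally_uniform:
  assumes R: "R \<ge> 0" and e: "e > 0"
  shows "\<forall>\<^sub>F n in sequentially. \<forall>j. norm (lattice_pt (N n) j) \<le> R \<longrightarrow>
    \<bar>cw_profile J (N n) j - gauss (lattice_pt (N n) j)\<bar> \<le> e"
proof -
  let ?err = "\<lambda>n. (\<Sum>l\<in>UNIV. (R + 1) ^ 4 / real (N n l)) + gap n * R\<^sup>2 / 2"
  have "?err \<longlonglongrightarrow> (\<Sum>l\<in>(UNIV :: 'd set). 0) + 0 * R\<^sup>2 / 2"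
    by (intro tendsto_intros gap_lim tendsto_divide_0[OF tendsto_const]
      filterlim_at_top_imp_at_infinity real_N_lim) simp
  \<comment> \<open>With the threshold ln (1 + e), the exponential of the error minus 1 is at most
    \<open>e\<close>.\<close>
  then have "\<forall>\<^sub>F n in sequentially. ?err n < ln (1 + e)"
    using e by (intro order_tendstoD) auto
  moreover have "\<forall>\<^sub>F n in sequentially. \<forall>l. 4 * (R + 1)\<^sup>2 \<le> real (N n l)"
    using N_ge[of "nat \<lceil>4 * (R + 1)\<^sup>2\<rceil>"] by eventually_elim (simp add: nat_le_iff ceiling_le_iff)
  ultimately show ?thesis using N_pos
  proof eventually_elim
    case (elim n)
    show ?case
    proof (intro allI impI)
      fix j assume xR: "norm (lattice_pt (N n) j) \<le> R"
      define x where "x = lattice_pt (N n) j"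
      have xl: "x $ l = (2 * real_of_int (j l) - real (N n l)) / sqrt (real (N n l))" for l
        by (simp add: x_def lattice_pt_def)
      have xlR: "\<bar>x $ l\<bar> \<le> R" for l
        using component_le_norm_cart[of x l] xR by (simp add: x_def)
      note b = binom_ratio_ln[OF _ R _ xl xlR]
      have pos: "binom_ratio (N n l) (j l) > 0" for l using b(1) elim by auto
      have bd: "\<bar>ln (binom_ratio (N n l) (j l)) + (x $ l)\<^sup>2 / 2\<bar> \<le> (R + 1) ^ 4 / real (N n l)" for l
        using b(2) elim by auto
      let ?a = "(\<Sum>l\<in>UNIV. ln (binom_ratio (N n l) (j l))) + x \<bullet> (coupling J (N n) *v x) / 2"
      let ?b = "- (x \<bullet> (Q *v x)) / 2"
      have prof: "cw_profile J (N n) j = exp ?a"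
        using pos by (simp add: cw_profile_def x_def exp_add exp_sum)
      have "?a - ?b = (\<Sum>l\<in>UNIV. ln (binom_ratio (N n l) (j l)) + (x $ l)\<^sup>2 / 2) +
        (x \<bullet> (coupling J (N n) *v x) - x \<bullet> (A *v x)) / 2"
        by (simp add: Q_form sum.distrib inner_vec_def[of x x] power2_eq_square sum_divide_distrib diff_divide_distrib)
      also have "\<bar>\<dots>\<bar> \<le> (\<Sum>l\<in>UNIV. (R + 1) ^ 4 / real (N n l)) + gap n * (x \<bullet> x) / 2"
      proof -
        have "\<bar>\<Sum>l\<in>UNIV. ln (binom_ratio (N n l) (j l)) + (x $ l)\<^sup>2 / 2\<bar> \<le> (\<Sum>l\<in>UNIV. (R + 1) ^ 4 / real (N n l))"
          by (intro order_trans[OF sum_abs] sum_mono bd)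
        moreover have "\<bar>(x \<bullet> (coupling J (N n) *v x) - x \<bullet> (A *v x)) / 2\<bar> \<le> gap n * (x \<bullet> x) / 2"
          using coupling_form_le[of x n] by simp
        ultimately show ?thesis by (intro order_trans[OF abs_triangle_ineq] add_mono)
      qed
      also have "\<dots> \<le> ?err n"
      proof -
        have "x \<bullet> x \<le> R\<^sup>2" using xR by (simp add: x_def power2_norm_eq_inner[symmetric] power_mono)
        moreover have "gap n \<ge> 0" by (simp add: gap_def sum_nonneg)
        ultimately show ?thesis by (simp add: mult_left_mono)
      qed
      finally have "\<bar>?a - ?b\<bar> \<le> ln (1 + e)" using elim(1) by linarith
      from abs_exp_diff_le[OF _ this] Q_nonneg[of x] e
      show "\<bar>cw_profile J (N n) j - gauss (lattice_pt (N n) j)\<bar> \<le> e"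
        by (simp add: prof gauss_def flip: x_def)
    qed
  qed
qed

text \<open>Inside a ball the local estimate applies; outside, both quantities lie between 0 and
  \<open>e\<close>, so their distance is at most \<open>e\<close>.\<close>

lemma profile_uniform:
  assumes e: "e > 0"
  shows "\<forall>\<^sub>F n in sequentially. \<forall>j. \<bar>cw_profile J (N n) j - gauss (lattice_pt (N n) j)\<bar> \<le> e"
proof -
  obtain K c where K: "K > 0" "c > 0"
    "\<forall>\<^sub>F n in sequentially. \<forall>j. cw_profile J (N n) j \<le> K * exp (- c * (lattice_pt (N n) j \<bullet> lattice_pt (N n) j))"
    "\<And>x. gauss x \<le> K * exp (- c * (x \<bullet> x))"
    by (rule profile_dominated) (rule that)
  \<comment> \<open>From exp t \<ge> t, the majorant at norm r is at most K / (c r^2), which is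
    below \<open>e\<close> beyond this radius.\<close>
  define R where "R = sqrt (K / (c * e))"
  have R: "R \<ge> 0" "R\<^sup>2 = K / (c * e)" using K(1,2) e by (auto simp: R_def)
  have tail: "K * exp (- c * (x \<bullet> x)) \<le> e" if "norm x > R" for x :: "real^'d"
  proof -
    have "R\<^sup>2 < (norm x)\<^sup>2" using that R(1) by (intro power_strict_mono) auto
    then have "K / (c * e) < x \<bullet> x" using R(2) by (simp add: power2_norm_eq_inner)
    then have "K < e * (c * (x \<bullet> x))" using K e by (simp add: field_simps)
    also have "\<dots> \<le> e * exp (c * (x \<bullet> x))"
      using e exp_ge_add_one_self[of "c * (x \<bullet> x)"] by (intro mult_left_mono) linarith+
    finally show ?thesis by (simp add: exp_minus field_simps)
  qed
  from profile_locally_uniform[OF R(1) e] K(3) show ?thesis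
  proof eventually_elim
    case (elim n)
    show ?case
    proof
      fix j
      let ?x = "lattice_pt (N n) j"
      show "\<bar>cw_profile J (N n) j - gauss ?x\<bar> \<le> e"
      proof (cases "norm ?x \<le> R")
        case False
        then have "K * exp (- c * (?x \<bullet> ?x)) \<le> e" by (intro tail) simp
        then have "cw_profile J (N n) j \<le> e" "gauss ?x \<le> e"
          using elim(2)[rule_format, of j] K(4)[of ?x] by linarith+
        then show ?thesis using cw_profile_nonneg[of J "N n" j] gauss_nonneg[of ?x] by linarith
      qed (use elim(1) in blast)
    qed
  qed
qed

section \<open>Step functions on the cells and the normalising constant\<close>

lemma lattice_pt_cell_lim: "(\<lambda>n. lattice_pt (N n) (cell (N n) y)) \<longlonglongrightarrow> y"
proof (rule vec_tendstoI)
  fix l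
  have "(\<lambda>n. y $ l - 2 / sqrt (real (N n l))) \<longlonglongrightarrow> y $ l - 0"
    by (intro tendsto_intros tendsto_divide_0[OF tendsto_const] filterlim_at_top_imp_at_infinity
      filterlim_compose[OF sqrt_at_top] real_N_lim)
  then have lower: "(\<lambda>n. y $ l - 2 / sqrt (real (N n l))) \<longlonglongrightarrow> y $ l" by simp
  show "(\<lambda>n. lattice_pt (N n) (cell (N n) y) $ l) \<longlonglongrightarrow> y $ l"
  proof (rule tendsto_sandwich[OF _ _ lower tendsto_const])
    show "\<forall>\<^sub>F n in sequentially. y $ l - 2 / sqrt (real (N n l)) \<le> lattice_pt (N n) (cell (N n) y) $ l"
      using N_pos by eventually_elim (use lattice_pt_cell(2) in \<open>smt (verit)\<close>)
    show "\<forall>\<^sub>F n in sequentially. lattice_pt (N n) (cell (N n) y) $ l \<le> y $ l"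
      using N_pos by eventually_elim (use lattice_pt_cell(1) in blast)
  qed
qed

text \<open>The evaluation point moves with \<open>n\<close>; uniform convergence reduces the claim
  to the continuity of \<open>gauss\<close>.\<close>

lemma profile_cell_lim: "(\<lambda>n. cw_profile J (N n) (cell (N n) y)) \<longlonglongrightarrow> gauss y"
proof -
  have "isCont gauss y"
    unfolding gauss_def by (intro continuous_intros isCont_o2[OF _ matrix_vector_mult_linear_continuous_at]) auto
  then have g: "(\<lambda>n. gauss (lattice_pt (N n) (cell (N n) y))) \<longlonglongrightarrow> gauss y"
    by (rule isCont_tendsto_compose[OF _ lattice_pt_cell_lim])
  have "(\<lambda>n. cw_profile J (N n) (cell (N n) y) - gauss (lattice_pt (N n) (cell (N n) y))) \<longlonglongrightarrow> 0"
  proof (rule tendstoI)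
    fix e :: real assume "e > 0"
    then have "e / 2 > 0" by simp
    from profile_uniform[OF this]
    show "\<forall>\<^sub>F n in sequentially. dist (cw_profile J (N n) (cell (N n) y) - gauss (lattice_pt (N n) (cell (N n) y))) 0 < e"
    proof eventually_elim
      case (elim n)
      show ?case using elim[rule_format, of "cell (N n) y"] \<open>e > 0\<close> by (simp add: dist_real_def)
    qed
  qed
  from tendsto_add[OF this g] show ?thesis by simp
qed

text \<open>Everything that depends on \<open>n\<close> alone: the partition function, the central
  binomials and the volume factor. Its limit is obtained from the total mass.\<close>

definition norm_const :: "nat \<Rightarrow> real" where
  "norm_const n = (\<Prod>l\<in>UNIV. sqrt (real (N n l))) / 2 ^ CARD('d) *
    (real (\<Prod>l\<in>UNIV. N n l choose (N n l div 2)) / cw_Z J (N n))"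

lemma scaled_prob_eq:
  assumes "\<forall>l. N n l > 0"
  shows "(\<Prod>l\<in>UNIV. sqrt (real (N n l))) / 2 ^ CARD('d) *
      \<P>(\<sigma> in curie_weiss J (N n). norm_sums (N n) \<sigma> = lattice_pt (N n) j) =
    norm_const n * cw_profile J (N n) j"
  using assms by (simp add: prob_lattice_pt norm_const_def)

lemma norm_const_pos:
  assumes "\<forall>l. N n l > 0"
  shows "norm_const n > 0"
  unfolding norm_const_def of_nat_prod using assms cw_Z_pos[of J "N n"]
  by (intro mult_pos_pos divide_pos_pos prod_pos) auto

lemma integral_profile_cell:
  assumes "\<forall>l. N n l > 0"
  shows "has_bochner_integral lborel (\<lambda>y. cw_profile J (N n) (cell (N n) y)) (1 / norm_const n)"
proof -
  have "has_bochner_integral lborel (\<lambda>y. norm_const n * cw_profile J (N n) (cell (N n) y)) 1"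
    using integral_prob_cell[of "N n" J] assms unfolding scaled_prob_eq[OF assms] by blast
  then have "has_bochner_integral lborel (\<lambda>y. (1 / norm_const n) * (norm_const n * cw_profile J (N n) (cell (N n) y)))
    (1 / norm_const n * 1)"
    by (rule has_bochner_integral_mult_right)
  then show ?thesis using norm_const_pos[OF assms] by simp
qed

lemma norm_const_lim: "norm_const \<longlonglongrightarrow> 1 / gauss_mass"
proof -
  obtain K c where K: "K > 0" "c > 0"
    "\<forall>\<^sub>F n in sequentially. \<forall>j. cw_profile J (N n) j \<le> K * exp (- c * (lattice_pt (N n) j \<bullet> lattice_pt (N n) j))"
    by (rule profile_dominated) (rule that)
  from eventually_conj[OF K(3) N_pos]
  obtain n0 where n0: "\<And>n j. n \<ge> n0 \<Longrightarrow> cw_profile J (N n) j \<le> K * exp (- c * (lattice_pt (N n) j \<bullet> lattice_pt (N n) j))"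
    "\<And>n l. n \<ge> n0 \<Longrightarrow> N n l > 0"
    unfolding eventually_sequentially by metis
  \<comment> \<open>The shift by \<open>n0\<close> makes the majorant hold for every term of the
    sequence.\<close>
  let ?s = "\<lambda>n y. cw_profile J (N (n + n0)) (cell (N (n + n0)) y)"
  \<comment> \<open>The majorant must be a function of \<open>y\<close>, whereas the bound is in the
    lattice point below \<open>y\<close>; moving it costs half the rate and the factor exp (4 c d).
    The scalar matrix presents it as a Gaussian of known integral.\<close>
  let ?w = "\<lambda>y::real^'d. K * exp (4 * c * real CARD('d)) * exp (- (y \<bullet> ((c *\<^sub>R mat 1) *v y)) / 2)"
  have dom: "?s n y \<le> ?w y" for n y
  proof -
    let ?x = "lattice_pt (N (n + n0)) (cell (N (n + n0)) y)"
    have "(y $ l)\<^sup>2 \<le> 2 * (?x $ l)\<^sup>2 + 8" for l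
    proof -
      have Npos: "N (n + n0) l > 0" using n0(2) by simp
      then have "2 / sqrt (real (N (n + n0) l)) \<le> 2" by (simp add: divide_simps)
      then have "\<bar>y $ l - ?x $ l\<bar> \<le> 2" using lattice_pt_cell[of "N (n + n0)" l y, OF Npos] by linarith
      then have "(y $ l - ?x $ l)\<^sup>2 \<le> 2\<^sup>2" by (simp only: abs_le_square_iff[symmetric])
      \<comment> \<open>Parallelogram law, giving y^2 \<le> 2 x^2 + 2 (y - x)^2.\<close>
      moreover have "(y $ l)\<^sup>2 + (y $ l - 2 * ?x $ l)\<^sup>2 = 2 * (?x $ l)\<^sup>2 + 2 * (y $ l - ?x $ l)\<^sup>2"
        by (simp add: power2_eq_square algebra_simps)
      moreover have "(y $ l - 2 * ?x $ l)\<^sup>2 \<ge> 0" by (rule zero_le_power2)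
      moreover have "(2::real)\<^sup>2 = 4" by simp
      ultimately show ?thesis by linarith
    qed
    then have "(\<Sum>l\<in>UNIV. (y $ l)\<^sup>2) \<le> (\<Sum>l\<in>UNIV. 2 * (?x $ l)\<^sup>2 + 8)" by (intro sum_mono)
    then have "y \<bullet> y \<le> 2 * (?x \<bullet> ?x) + 8 * real CARD('d)"
      by (simp add: inner_vec_def power2_eq_square sum.distrib sum_distrib_left)
    then have "c * (y \<bullet> y) \<le> c * (2 * (?x \<bullet> ?x) + 8 * real CARD('d))" using K(2) by (intro mult_left_mono) auto
    then have "- c * (?x \<bullet> ?x) \<le> 4 * c * real CARD('d) + - (c * (y \<bullet> y)) / 2" by (simp add: algebra_simps)
    then have "K * exp (- c * (?x \<bullet> ?x)) \<le> K * exp (4 * c * real CARD('d) + - (c * (y \<bullet> y)) / 2)"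
      using K(1) by (intro mult_left_mono) auto
    moreover have "?s n y \<le> K * exp (- c * (?x \<bullet> ?x))" by (rule n0(1)) simp
    moreover have "K * exp (4 * c * real CARD('d) + - (c * (y \<bullet> y)) / 2) = ?w y"
      unfolding exp_add by (simp add: scaleR_matrix_vector_assoc[symmetric])
    ultimately show ?thesis by linarith
  qed
  have "(\<lambda>n. integral\<^sup>L lborel (?s n)) \<longlonglongrightarrow> integral\<^sup>L lborel gauss"
  proof (rule integral_dominated_convergence)
    show "integrable lborel ?w"
      using gauss_integral_pos_def[of "c *\<^sub>R mat 1 :: real^'d^'d", OF pos_def_scaleR_mat_1[OF K(2)]]
      by (intro integrable_mult_right) (simp only: has_bochner_integral_iff)
    show "?s n \<in> borel_measurable lborel" for n
      using integral_profile_cell[of "n + n0"] n0(2) by (auto simp: has_bochner_integral_iff)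
    show "gauss \<in> borel_measurable lborel"
      using gauss_integral_pos_def[OF Q_pos_def] by (auto simp: has_bochner_integral_iff gauss_def[abs_def])
    show "AE y in lborel. (\<lambda>n. ?s n y) \<longlonglongrightarrow> gauss y"
      by (intro AE_I2 LIMSEQ_ignore_initial_segment[OF profile_cell_lim])
    show "AE y in lborel. norm (?s n y) \<le> ?w y" for n
      using dom by (intro AE_I2) (simp add: cw_profile_nonneg)
  qed
  moreover have "integral\<^sup>L lborel (?s n) = 1 / norm_const (n + n0)" for n
    using integral_profile_cell[of "n + n0"] n0(2) by (simp add: has_bochner_integral_iff)
  moreover have "integral\<^sup>L lborel gauss = gauss_mass"
    using gauss_integral_pos_def[OF Q_pos_def] by (simp add: has_bochner_integral_iff gauss_def[abs_def] gauss_mass_def)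
  ultimately have "(\<lambda>n. 1 / norm_const (n + n0)) \<longlonglongrightarrow> gauss_mass" by simp
  then have "(\<lambda>n. 1 / norm_const n) \<longlonglongrightarrow> gauss_mass" by (rule LIMSEQ_offset)
  then have "(\<lambda>n. 1 / (1 / norm_const n)) \<longlonglongrightarrow> 1 / gauss_mass"
    using gauss_mass_pos by (intro tendsto_intros) auto
  then show ?thesis by simp
qed

lemma local_limit:
  assumes e: "e > 0"
  shows "\<forall>\<^sub>F n in sequentially. \<forall>x\<in>sum_lattice (N n).
    \<bar>(\<Prod>l\<in>UNIV. sqrt (real (N n l))) / 2 ^ CARD('d) *
      \<P>(\<sigma> in curie_weiss J (N n). norm_sums (N n) \<sigma> = x) - gauss x / gauss_mass\<bar> \<le> e"
proof -
  \<comment> \<open>An eventual bound for \<open>norm_const\<close>: a profile error of e / (2 B)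
    contributes at most e / 2 after multiplication, and \<open>gauss_le_1\<close> leaves e / 2 for
    the error of the constant.\<close>
  define B where "B = 1 / gauss_mass + 1"
  have B: "B > 0" using gauss_mass_pos by (simp add: B_def add_pos_pos)
  have "\<forall>\<^sub>F n in sequentially. norm_const n < B"
    by (rule order_tendstoD[OF norm_const_lim]) (simp add: B_def)
  moreover have "\<forall>\<^sub>F n in sequentially. dist (norm_const n) (1 / gauss_mass) < e / 2"
    using e by (intro tendstoD[OF norm_const_lim]) auto
  moreover have "\<forall>\<^sub>F n in sequentially. \<forall>j. \<bar>cw_profile J (N n) j - gauss (lattice_pt (N n) j)\<bar> \<le> e / (2 * B)"
    using e B by (intro profile_uniform) auto
  ultimately show ?thesis using N_pos
  proof eventually_elim
    case (elim n)
    show ?case unfolding sum_lattice_eq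
    proof clarify
      fix j
      let ?x = "lattice_pt (N n) j" and ?C = "norm_const n"
      let ?h = "cw_profile J (N n) j"
      have C: "?C > 0" using norm_const_pos elim by blast
      have "?C * ?h - gauss ?x / gauss_mass = ?C * (?h - gauss ?x) + (?C - 1 / gauss_mass) * gauss ?x"
        by (simp add: algebra_simps)
      also have "\<bar>\<dots>\<bar> \<le> ?C * \<bar>?h - gauss ?x\<bar> + \<bar>?C - 1 / gauss_mass\<bar> * gauss ?x"
        using C gauss_nonneg[of ?x] by (metis abs_mult abs_of_nonneg abs_triangle_ineq less_imp_le)
      also have "\<dots> \<le> B * (e / (2 * B)) + e / 2 * 1"
        using elim C e B gauss_nonneg[of ?x] gauss_le_1[of ?x]
        by (intro add_mono mult_mono) (auto simp: dist_real_def)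
      also have "\<dots> = e" using B by simp
      finally show "\<bar>(\<Prod>l\<in>UNIV. sqrt (real (N n l))) / 2 ^ CARD('d) *
        \<P>(\<sigma> in curie_weiss J (N n). norm_sums (N n) \<sigma> = ?x) - gauss ?x / gauss_mass\<bar> \<le> e"
        using scaled_prob_eq[of n j] elim by simp
    qed
  qed
qed

end

text \<open>Positive sizes with sum \<open>n\<close> exist only for \<open>n \<ge> CARD('d)\<close>,
  hence the restriction on \<open>n\<close>. The supremum is taken in \<open>ereal\<close>, where it
  is meaningful for every set, so convergence to 0 also asserts that it is eventually
  finite.\<close>

theorem theorem6:
  fixes N :: "nat \<Rightarrow> 'd::finite \<Rightarrow> nat"
    and \<alpha> :: "real^'d"
    and J \<Sigma> :: "real^'d^'d"
    and \<beta> :: real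
  assumes sizes_pos: "\<And>n l. n \<ge> CARD('d) \<Longrightarrow> N n l > 0"
    and sizes_sum: "\<And>n. n \<ge> CARD('d) \<Longrightarrow> (\<Sum>l\<in>UNIV. N n l) = n"
    and sizes_lim: "\<And>l. filterlim (\<lambda>n. N n l) at_top sequentially"
    and ratio_lim: "\<And>l. (\<lambda>n. real (N n l) / real n) \<longlonglongrightarrow> \<alpha> $ l"
    and high_temp:
      "(homogeneous \<beta> J \<and> \<beta> < 1 \<and> \<Sigma> = const_mat (\<beta> / (1 - \<beta>))) \<or>
       (heterogeneous J \<and> pos_def (H_mat \<alpha> J) \<and> \<Sigma> = matrix_inv (H_mat \<alpha> J))"
  shows "pos_def (cov_mat \<alpha> \<Sigma>) \<and>
    (\<lambda>n. SUP x\<in>sum_lattice (N n).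
       ereal \<bar>(\<Prod>l\<in>UNIV. sqrt (real (N n l))) / 2 ^ CARD('d) *
                \<P>(\<sigma> in curie_weiss J (N n). norm_sums (N n) \<sigma> = x)
              - normal_density_mat (cov_mat \<alpha> \<Sigma>) x\<bar>) \<longlonglongrightarrow> 0"
proof
  have \<alpha>_nonneg: "\<alpha> $ l \<ge> 0" for l
    by (rule LIMSEQ_le_const[OF ratio_lim]) auto
  have ev: "\<forall>\<^sub>F n in sequentially. n \<ge> CARD('d)" by (rule eventually_ge_at_top)
  have card_pos: "CARD('d) > 0" by simp
  have \<alpha>_sum: "(\<Sum>l\<in>UNIV. \<alpha> $ l) = 1"
  proof (rule LIMSEQ_unique)
    show "(\<lambda>n. \<Sum>l\<in>UNIV. real (N n l) / real n) \<longlonglongrightarrow> (\<Sum>l\<in>UNIV. \<alpha> $ l)"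
      by (intro tendsto_sum ratio_lim)
    have "\<forall>\<^sub>F n in sequentially. (\<Sum>l\<in>UNIV. real (N n l) / real n) = 1"
      using ev
    proof eventually_elim
      case (elim n)
      then have "n > 0" using card_pos by linarith
      then show ?case using sizes_sum[OF elim] by (simp flip: sum_divide_distrib of_nat_sum)
    qed
    then show "(\<lambda>n. \<Sum>l\<in>UNIV. real (N n l) / real n) \<longlonglongrightarrow> 1" by (rule tendsto_eventually)
  qed
  note S = high_temp_resolvent[OF \<alpha>_sum high_temp]
  let ?D = "diag_mat (\<chi> i. sqrt (\<alpha> $ i)) :: real^'d^'d"
  define A where "A = ?D ** J ** ?D"
  define Q where "Q = mat 1 - A"
  show C: "pos_def (cov_mat \<alpha> \<Sigma>)" by (rule cov_mat_pos_def[OF S(3,4)])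
  have CQ: "cov_mat \<alpha> \<Sigma> ** Q = mat 1"
    unfolding Q_def A_def by (rule cov_mat_inverse[OF \<alpha>_nonneg S(1)])
  have "transpose Q = Q"
    by (simp add: Q_def A_def transpose_diff matrix_transpose_mul matrix_mul_assoc S(2))
  then have Q: "pos_def Q" by (rule pos_def_from_left_inverse[OF C CQ])
  interpret curie_weiss_limit N J A Q
  proof
    fix l m
    have "(\<lambda>n. J $ l $ m * (sqrt (real (N n l) / real n) * sqrt (real (N n m) / real n))) \<longlonglongrightarrow>
      J $ l $ m * (sqrt (\<alpha> $ l) * sqrt (\<alpha> $ m))"
      by (intro tendsto_intros ratio_lim)
    moreover have "\<forall>\<^sub>F n in sequentially. J $ l $ m * (sqrt (real (N n l) / real n) * sqrt (real (N n m) / real n)) =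
      coupling J (N n) $ l $ m"
      using ev by eventually_elim (simp add: coupling_def sizes_sum real_sqrt_divide)
    ultimately have "(\<lambda>n. coupling J (N n) $ l $ m) \<longlonglongrightarrow> J $ l $ m * (sqrt (\<alpha> $ l) * sqrt (\<alpha> $ m))"
      by (rule Lim_transform_eventually)
    then show "(\<lambda>n. coupling J (N n) $ l $ m) \<longlonglongrightarrow> A $ l $ m"
      by (simp add: A_def diag_conj_component mult_ac)
  qed (use sizes_lim Q in \<open>simp_all add: Q_def\<close>)
  have dens: "normal_density_mat (cov_mat \<alpha> \<Sigma>) x = gauss x / gauss_mass" for x
    by (simp add: normal_density_mat_inverse[OF CQ Q] gauss_def gauss_mass_def)
  let ?F = "\<lambda>n. SUP x\<in>sum_lattice (N n). ereal \<bar>(\<Prod>l\<in>UNIV. sqrt (real (N n l))) / 2 ^ CARD('d) *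
    \<P>(\<sigma> in curie_weiss J (N n). norm_sums (N n) \<sigma> = x) - normal_density_mat (cov_mat \<alpha> \<Sigma>) x\<bar>"
  have nonneg: "0 \<le> ?F n" for n
  proof -
    \<comment> \<open>In \<open>ereal\<close> the supremum of the empty set is -\<infinity>, so the
      lower bound requires a point of the lattice.\<close>
    have "lattice_pt (N n) (\<lambda>_. 0) \<in> sum_lattice (N n)" by (simp add: sum_lattice_eq)
    then show ?thesis by (rule SUP_upper2) simp
  qed
  show "?F \<longlonglongrightarrow> 0"
  proof (rule order_tendstoI)
    fix a :: ereal assume "a < 0"
    then show "\<forall>\<^sub>F n in sequentially. a < ?F n" using nonneg by (intro always_eventually) (auto intro: less_le_trans)
  next
    fix a :: ereal assume "0 < a"
    \<comment> \<open>\<open>a\<close> may be infinite, so a real number is put between 0 and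
      \<open>a\<close>.\<close>
    then obtain e where e: "0 < ereal e" "ereal e < a" by (metis ereal_dense2 zero_ereal_def)
    then have "e > 0" by simp
    from local_limit[OF this] show "\<forall>\<^sub>F n in sequentially. ?F n < a"
    proof eventually_elim
      case (elim n)
      then have "?F n \<le> ereal e" by (intro SUP_least) (simp add: dens)
      then show ?case using e(2) by (rule le_less_trans)
    qed
  qed
qed

end
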